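(* Fix a positive integer $m$ and put $p=\frac{2m}{m+1}$. Then the Lorentz space $\ell_{p,1}$ is the smallest symmetric Banach sequence space $X$ with $\mathrm{BH}^{\mathrm{mult}}_X(m)<\infty$, i.e. $\mathrm{BH}^{\mathrm{mult}}_{\ell_{p,1}}(m)<\infty$, and for every symmetric Banach sequence space $X$ with $\mathrm{BH}^{\mathrm{mult}}_X(m)<\infty$ one has $\ell_{p,1}\hookrightarrow X$ continuously (there is $C>0$ with $\|x\|_X\le C\|x\|_{\ell_{p,1}}$ for all $x$). Likewise, $\ell_{p,1}$ is the smallest symmetric Banach sequence space $X$ with $\mathrm{BH}^{\mathrm{pol}}_X(m)<\infty$, i.e. $\mathrm{BH}^{\mathrm{pol}}_{\ell_{p,1}}(m)<\infty$, and every symmetric Banach sequence space $X$ with $\mathrm{BH}^{\mathrm{pol}}_X(m)<\infty$ satisfies $\ell_{p,1}\hookrightarrow X$ continuously.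
   Context: A symmetric Banach sequence space $X$ is a Banach lattice of complex sequences (on $\mathbb{N}$, with counting measure) such that $x\in X$, $|y|$ and $|x|$ equidistributed imply $y\in X$ and $\|y\|_X=\|x\|_X$; for any finite or countable index set $I$ and $x=(x_i)_{i\in I}$ we set $\|x\|_X:=\|x^*\|_X$, where $x^*=(x^*_k)$ is the non-increasing rearrangement of $(|x_i|)_{i\in I}$. For $1\le p<\infty$, $1\le q<\infty$, the Lorentz space $\ell_{p,q}(I)$ consists of all $x$ with $\|x\|_{\ell_{p,q}}=\big(\sum_k (x_k^* )^q(k^{q/p}-(k-1)^{q/p})\big)^{1/q}<\infty$, and $\|x\|_{\ell_{p,\infty}}=\sup_k k^{1/p}x_k^*$. For $m,n\in\mathbb{N}$ let $\mathcal{M}(m,n)=\{\mathbf{i}=(i_1,\dots,i_m): 1\le i_k\le n\}$ and $\mathcal{J}(m,n)=\{\mathbf{j}\in\mathcal{M}(m,n): j_1\le\dots\le j_m\}$. For a complex matrix $a=(a_{\mathbf i})_{\mathbf i\in\mathcal M(m,n)}$ let $\|a\|_\infty=\sup\big|\sum_{\mathbf i\in\mathcal M(m,n)}a_{\mathbf i}x^1_{i_1}\cdots x^m_{i_m}\big|$, the sup over $x^1,\dots,x^m\in\mathbb{C}^n$ with $\|x^k\|_\infty\le1$. $\mathrm{BH}^{\mathrm{mult}}_X(m)\in[1,\infty]$ is the best constant $C\ge1$ such that $\|(a_{\mathbf i})_{\mathbf i\in\mathcal M(m,n)}\|_X\le C\|a\|_\infty$ for all $n$ and all such matrices. Every $m$-homogeneous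 polynomial on $\mathbb{C}^n$ is uniquely written $P(z)=\sum_{\mathbf j\in\mathcal J(m,n)}c_{\mathbf j}z_{j_1}\cdots z_{j_m}$; $\|P\|_\infty=\sup_{\|z\|_\infty\le1}|P(z)|$. $\mathrm{BH}^{\mathrm{pol}}_X(m)\in[1,\infty]$ is the best constant $C\ge1$ such that $\|(c_{\mathbf j})_{\mathbf j\in\mathcal J(m,n)}\|_X\le C\|P\|_\infty$ for all $n$ and all such $P$. *)

theory Defs
  imports Complex_Main "HOL-Library.FuncSet" "HOL-Library.Extended_Nonnegative_Real"
begin

type_synonym seq = "nat \<Rightarrow> complex"
(* a sequence space: carrier set together with its norm *)
type_synonym seqspace = "seq set \<times> (seq \<Rightarrow> real)"

(* non-increasing rearrangement, 0-indexed: decr I x k = x^*_{k+1} (value \<infinity> allowed) *)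
definition decr :: "'i set \<Rightarrow> ('i \<Rightarrow> complex) \<Rightarrow> nat \<Rightarrow> ennreal" where
  "decr I x k = Inf {t. finite {i\<in>I. t < ennreal (cmod (x i))}
                     \<and> card {i\<in>I. t < ennreal (cmod (x i))} \<le> k}"

definition fin_rearr :: "'i set \<Rightarrow> ('i \<Rightarrow> complex) \<Rightarrow> seq" where
  "fin_rearr I x = (\<lambda>k. complex_of_real (enn2real (decr I x k)))"

definition equidistributed :: "seq \<Rightarrow> seq \<Rightarrow> bool" where
  "equidistributed x y \<longleftrightarrow> (\<forall>t::real. t \<ge> 0 \<longrightarrow>
      (finite {i. cmod (x i) > t} \<longleftrightarrow> finite {i. cmod (y i) > t})
      \<and> card {i. cmod (x i) > t} = card {i. cmod (y i) > t})"

definition sym_banach_seq_space :: "seqspace \<Rightarrow> bool" where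
  "sym_banach_seq_space X \<longleftrightarrow> (let S = fst X; N = snd X in
     (\<lambda>_. 0) \<in> S \<and> (\<forall>x\<in>S. \<forall>y\<in>S. (\<lambda>i. x i + y i) \<in> S) \<and> (\<forall>c::complex. \<forall>x\<in>S. (\<lambda>i. c * x i) \<in> S)
     \<and> (\<forall>x\<in>S. N x \<ge> 0 \<and> (N x = 0 \<longleftrightarrow> x = (\<lambda>_. 0)))
     \<and> (\<forall>c::complex. \<forall>x\<in>S. N (\<lambda>i. c * x i) = cmod c * N x)
     \<and> (\<forall>x\<in>S. \<forall>y\<in>S. N (\<lambda>i. x i + y i) \<le> N x + N y)
     \<and> (\<forall>x\<in>S. \<forall>y. (\<forall>i. cmod (y i) \<le> cmod (x i)) \<longrightarrow> y \<in> S \<and> N y \<le> N x)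
     \<and> (\<forall>f::nat \<Rightarrow> seq. (\<forall>n. f n \<in> S) \<and>
            (\<forall>e>0. \<exists>M. \<forall>n\<ge>M. \<forall>k\<ge>M. N (\<lambda>i. f n i - f k i) < e)
          \<longrightarrow> (\<exists>x\<in>S. \<forall>e>0. \<exists>M. \<forall>n\<ge>M. N (\<lambda>i. f n i - x i) < e))
     \<and> (\<forall>x\<in>S. \<forall>y. equidistributed x y \<longrightarrow> y \<in> S \<and> N y = N x))"

definition xnorm :: "seqspace \<Rightarrow> seq \<Rightarrow> ennreal" where
  "xnorm X x = (if x \<in> fst X then ennreal (snd X x) else top)"

(* index sets M(m,n) and J(m,n); tuples are functions on {..<m} (position k = i_{k+1}) *)
definition Mset :: "nat \<Rightarrow> nat \<Rightarrow> (nat \<Rightarrow> nat) set" where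
  "Mset m n = PiE {..<m} (\<lambda>_. {1..n})"

definition Jset :: "nat \<Rightarrow> nat \<Rightarrow> (nat \<Rightarrow> nat) set" where
  "Jset m n = {j \<in> Mset m n. \<forall>k. Suc k < m \<longrightarrow> j k \<le> j (Suc k)}"

definition mult_norm :: "nat \<Rightarrow> nat \<Rightarrow> ((nat \<Rightarrow> nat) \<Rightarrow> complex) \<Rightarrow> real" where
  "mult_norm m n a = (SUP x \<in> {x :: nat \<Rightarrow> nat \<Rightarrow> complex. \<forall>k<m. \<forall>i\<in>{1..n}. cmod (x k i) \<le> 1}.
       cmod (\<Sum>i\<in>Mset m n. a i * (\<Prod>k<m. x k (i k))))"

definition pol_norm :: "nat \<Rightarrow> nat \<Rightarrow> ((nat \<Rightarrow> nat) \<Rightarrow> complex) \<Rightarrow> real" where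
  "pol_norm m n c = (SUP z \<in> {z :: nat \<Rightarrow> complex. \<forall>i\<in>{1..n}. cmod (z i) \<le> 1}.
       cmod (\<Sum>j\<in>Jset m n. c j * (\<Prod>k<m. z (j k))))"

definition BH_mult :: "seqspace \<Rightarrow> nat \<Rightarrow> ennreal" where
  "BH_mult X m = Inf {C. 1 \<le> C \<and> (\<forall>n a. xnorm X (fin_rearr (Mset m n) a) \<le> C * ennreal (mult_norm m n a))}"

definition BH_pol :: "seqspace \<Rightarrow> nat \<Rightarrow> ennreal" where
  "BH_pol X m = Inf {C. 1 \<le> C \<and> (\<forall>n c. xnorm X (fin_rearr (Jset m n) c) \<le> C * ennreal (pol_norm m n c))}"

(* Lorentz l_{p,1} norm: sum_k x^*_k (k^{1/p} - (k-1)^{1/p}), shifted to 0-indexing *)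
definition lorentz_p1_norm :: "real \<Rightarrow> seq \<Rightarrow> ennreal" where
  "lorentz_p1_norm p x = (\<Sum>k. decr (UNIV::nat set) x k
        * ennreal (real (Suc k) powr (1/p) - real k powr (1/p)))"

definition lorentz_p1 :: "real \<Rightarrow> seqspace" where
  "lorentz_p1 p = ({x. lorentz_p1_norm p x < top}, \<lambda>x. enn2real (lorentz_p1_norm p x))"

definition embeds :: "seqspace \<Rightarrow> seqspace \<Rightarrow> bool" where
  "embeds X Y \<longleftrightarrow> (\<exists>C>0. \<forall>x\<in>fst X. x \<in> fst Y \<and> snd Y x \<le> C * snd X x)"

end

(*
  Upper bounds. A multilinear form controls, by Khinchine's inequality in all but one variable, the
  mixed norms sum_v (sum_{i_k = v} |a_i|^2)^(1/2). Any enumeration of the entries, weighted by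
  r^(1/p - 1), is dominated by these mixed norms: distribute the entries over the m families of
  hyperplanes {i_k = v} so that no hyperplane carries much squared weight, and apply the
  Cauchy-Schwarz inequality in each of them. Polynomials reduce to symmetric forms by polarization.

  Minimality. The form with coefficients prod_k exp(2 pi i j_k j_{k+1} / n) has n^m unimodular
  coefficients but norm at most n^((m+1)/2), so the fundamental function of X is O(N^(1/p));
  writing a decreasing sequence as a sum of multiples of initial indicators then gives the embedding.
  For polynomials the m arguments are realised as disjoint blocks of variables.
*)
theory Submission
  imports Defs "HOL-Analysis.Analysis"
begin

section \<open>Rearrangements and weighted sums\<close>

text \<open>The classical inequality reaches only \<open>l_p\<close>, a strictly larger space than
  \<open>l_{p,1}\<close> when \<open>m >= 2\<close>, so the weights themselves have to be handled.
  The exponent is forced from both sides. Cauchy-Schwarz squares the weight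
  \<open>r^(1/p - 1)\<close> into \<open>r^(1/m - 1)\<close>, whose first \<open>r\<close> terms sum
  to at most \<open>m r^(1/m)\<close>. Hence each of the \<open>m\<close> directions has at most of
  the order of \<open>r^(1/m)\<close> overloaded hyperplanes, and the points overloaded in every
  direction form a small proportion of the first \<open>r\<close>. They cannot be charged anywhere,
  but ranking them anew among themselves gains a constant factor, so induction absorbs them. In the
  other direction, \<open>n^m\<close> unimodular coefficients against a norm
  \<open>n^((m+1)/2)\<close> give exactly \<open>(n^m)^(1/p)\<close>. The Lorentz norm is used
  throughout as a supremum over finite sets with injective ranks. This needs decreasing weights,
  that is \<open>1 <= p\<close>, and it avoids sorting the coefficients.\<close>

lemma less_decr_iff:
  "t < decr I x k \<longleftrightarrow> (\<exists>B\<subseteq>I. finite B \<and> card B = Suc k \<and> (\<forall>i\<in>B. t < ennreal (cmod (x i))))"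
proof
  let ?D = "\<lambda>t. {i\<in>I. t < ennreal (cmod (x i))}"
  assume "t < decr I x k"
  then have "\<not> (finite (?D t) \<and> card (?D t) \<le> k)"
    unfolding decr_def using Inf_lower by (metis (no_types, lifting) mem_Collect_eq not_less)
  then have "\<exists>B\<subseteq>?D t. finite B \<and> card B = Suc k"
  proof (cases "finite (?D t)")
    case True
    with \<open>\<not> (finite (?D t) \<and> card (?D t) \<le> k)\<close> have "Suc k \<le> card (?D t)" by simp
    then obtain B where "B \<subseteq> ?D t" "card B = Suc k" "finite B" by (rule obtain_subset_with_card_n)
    then show ?thesis by blast
  next
    case False
    then show ?thesis using infinite_arbitrarily_large by blast
  qed
  then show "\<exists>B\<subseteq>I. finite B \<and> card B = Suc k \<and> (\<forall>i\<in>B. t < ennreal (cmod (x i)))"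
    by blast
next
  assume "\<exists>B\<subseteq>I. finite B \<and> card B = Suc k \<and> (\<forall>i\<in>B. t < ennreal (cmod (x i)))"
  then obtain B where B: "B \<subseteq> I" "finite B" "card B = Suc k" "\<forall>i\<in>B. t < ennreal (cmod (x i))"
    by blast
  \<comment> \<open>An infimum of values above \<open>t\<close> may still equal \<open>t\<close>, so
    a value in between is interposed: every level below the minimum is exceeded by all of
    \<open>B\<close> and is therefore not admissible.\<close>
  let ?u = "Min ((\<lambda>i. ennreal (cmod (x i))) ` B)"
  have "B \<noteq> {}" using B(3) by auto
  then have "t < ?u" using B by (subst Min_gr_iff) auto
  also have "?u \<le> decr I x k"
    unfolding decr_def
  proof (rule Inf_greatest, rule ccontr)
    fix s assume s: "s \<in> {t. finite {i\<in>I. t < ennreal (cmod (x i))} \<and> card {i\<in>I. t < ennreal (cmod (x i))} \<le> k}"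
      and "\<not> ?u \<le> s"
    then have "s < ?u" by simp
    then have "B \<subseteq> {i\<in>I. s < ennreal (cmod (x i))}"
      using B(1,2) \<open>B \<noteq> {}\<close> by (subst (asm) Min_gr_iff) auto
    then have "Suc k \<le> card {i\<in>I. s < ennreal (cmod (x i))}"
      using s B(3) card_mono by (metis (mono_tags, lifting) mem_Collect_eq)
    then show False using s by simp
  qed
  finally show "t < decr I x k" .
qed

lemma ennreal_eqI_less: "(\<And>t::ennreal. t < a \<longleftrightarrow> t < b) \<Longrightarrow> a = b"
  by (meson not_less_iff_gr_or_eq)

lemma antimono_decr: "antimono (decr I x)"
proof (rule antimonoI)
  fix k l :: nat assume "k \<le> l"
  show "decr I x l \<le> decr I x k"
    unfolding decr_def by (rule Inf_superset_mono) (use \<open>k \<le> l\<close> in auto)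
qed

lemma decr_less_top:
  assumes "\<And>i. i \<in> I \<Longrightarrow> cmod (x i) \<le> c"
  shows "decr I x k < top"
proof (rule ccontr)
  assume "\<not> decr I x k < top"
  then have "ennreal c < decr I x k" by (simp add: less_top[symmetric])
  then obtain B where "B \<subseteq> I" "card B = Suc k" "\<forall>i\<in>B. ennreal c < ennreal (cmod (x i))"
    unfolding less_decr_iff by blast
  then show False
    using assms by (metis card.empty ennreal_leI ex_in_conv nat.distinct(1) not_less subsetD)
qed

text \<open>\<open>fin_rearr\<close> passes through \<open>enn2real\<close>, which sends infinity to
  0; finiteness of the values makes this faithful. Any \<open>Suc k\<close> indices include one that
  is at least \<open>k\<close>, so a decreasing sequence is its own rearrangement.\<close>

lemma decr_rearrangement:
  assumes "\<And>k. decr I x k < top"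
  shows "decr UNIV (fin_rearr I x) = decr I x"
proof (rule ext, rule ennreal_eqI_less)
  fix k t
  have eq: "ennreal (cmod (fin_rearr I x j)) = decr I x j" for j
    using assms by (simp add: fin_rearr_def)
  show "t < decr UNIV (fin_rearr I x) k \<longleftrightarrow> t < decr I x k"
  proof
    assume "t < decr UNIV (fin_rearr I x) k"
    then obtain B where B: "finite B" "card B = Suc k" "\<forall>j\<in>B. t < decr I x j"
      unfolding less_decr_iff[where I = UNIV] eq by blast
    have "\<not> B \<subseteq> {..<k}"
      using B(2) card_mono[of "{..<k}" B] by auto
    then obtain j where "j \<in> B" "k \<le> j" by (meson lessThan_iff not_le subsetI)
    then show "t < decr I x k"
      using B(3) antimono_decr by (metis antimonoD order_less_le_trans)
  next
    assume "t < decr I x k"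
    then have "\<forall>j\<in>{..k}. t < decr I x j"
      using antimono_decr by (metis antimonoD atMost_iff order_less_le_trans)
    then show "t < decr UNIV (fin_rearr I x) k"
      unfolding less_decr_iff[where I = UNIV] eq by (intro exI[of _ "{..k}"]) auto
  qed
qed

text \<open>The rearrangement inequality: the smallest entry is given the largest rank and split
  off. The ranks may have gaps; injectivity on \<open>Suc N\<close> points still puts the largest
  rank at \<open>N\<close> or beyond.\<close>

lemma weighted_sum_le_decr:
  fixes x :: "'i \<Rightarrow> complex" and w :: "nat \<Rightarrow> real"
  assumes w: "antimono w" "\<And>k. 0 \<le> w k"
  assumes "finite A" "A \<subseteq> I" "inj_on \<rho> A"
  shows "ennreal (\<Sum>i\<in>A. cmod (x i) * w (\<rho> i)) \<le> (\<Sum>k<card A. decr I x k * ennreal (w k))"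
  using assms(3-5)
proof (induction "card A" arbitrary: A \<rho>)
  case 0
  then show ?case by simp
next
  case (Suc N)
  define i where "i = arg_min_on (\<lambda>i. cmod (x i)) A"
  have "A \<noteq> {}" using Suc.hyps(2) by auto
  then have i: "i \<in> A" "\<And>j. j \<in> A \<Longrightarrow> cmod (x i) \<le> cmod (x j)"
    using Suc.prems(1) unfolding i_def by (auto intro: arg_min_if_finite(1) arg_min_least)
  have cA: "card (A - {i}) = N" using Suc i by simp
  have xi: "ennreal (cmod (x i)) \<le> decr I x N"
  proof (rule ccontr)
    assume "\<not> ennreal (cmod (x i)) \<le> decr I x N"
    then have "decr I x N < ennreal (cmod (x i))" by simp
    moreover have "\<forall>j\<in>A. ennreal (cmod (x i)) \<le> ennreal (cmod (x j))"
      using i(2) by (auto intro: ennreal_leI)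
    ultimately have "\<forall>j\<in>A. decr I x N < ennreal (cmod (x j))"
      by (meson order_less_le_trans)
    then have "decr I x N < decr I x N"
      unfolding less_decr_iff[of _ I x N] using Suc.prems(1,2) Suc.hyps(2) by metis
    then show False by simp
  qed
  obtain j where j: "j \<in> A" "\<And>l. l \<in> A \<Longrightarrow> \<rho> l \<le> \<rho> j"
    using obtains_MAX[OF Suc.prems(1) \<open>A \<noteq> {}\<close>, of \<rho>] Suc.prems(1)
    by (metis Max_ge finite_imageI imageI)
  have "N \<le> \<rho> j"
  proof (rule ccontr)
    assume "\<not> N \<le> \<rho> j"
    then have "\<rho> ` A \<subseteq> {..<N}" using j(2) by fastforce
    then show False
      using card_mono[of "{..<N}" "\<rho> ` A"] card_image[OF Suc.prems(3)] Suc.hyps(2) by auto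
  qed
  \<comment> \<open>Moving the largest rank to the smallest entry does not decrease the sum.\<close>
  define \<sigma> where "\<sigma> = \<rho>(j := \<rho> i, i := \<rho> j)"
  have le: "(\<Sum>l\<in>A. cmod (x l) * w (\<rho> l)) \<le> (\<Sum>l\<in>A. cmod (x l) * w (\<sigma> l))"
  proof (cases "i = j")
    case True then show ?thesis by (simp add: \<sigma>_def)
  next
    case False
    have s: "(\<Sum>l\<in>A. f l) = f i + f j + (\<Sum>l\<in>A - {i} - {j}. f l)" for f :: "'i \<Rightarrow> real"
      using False Suc.prems(1) i(1) j(1)
      by (simp add: sum.remove[of A i] sum.remove[of "A - {i}" j])
    have "0 \<le> (cmod (x j) - cmod (x i)) * (w (\<rho> i) - w (\<rho> j))"
      using i(2)[OF j(1)] antimonoD[OF w(1) j(2)[OF i(1)]] by simp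
    then show ?thesis
      using False unfolding s[of "\<lambda>l. cmod (x l) * w (\<rho> l)"] s[of "\<lambda>l. cmod (x l) * w (\<sigma> l)"]
      by (simp add: \<sigma>_def algebra_simps)
  qed
  have inj: "inj_on \<sigma> (A - {i})"
    using Suc.prems(3) i(1) j(1) unfolding \<sigma>_def inj_on_def by auto
  have IH: "ennreal (\<Sum>l\<in>A - {i}. cmod (x l) * w (\<sigma> l)) \<le> (\<Sum>k<N. decr I x k * ennreal (w k))"
    using Suc.hyps(1)[of "A - {i}" \<sigma>] cA Suc.prems(1,2) inj by auto
  have "ennreal (\<Sum>l\<in>A. cmod (x l) * w (\<rho> l))
      \<le> ennreal ((\<Sum>l\<in>A - {i}. cmod (x l) * w (\<sigma> l)) + cmod (x i) * w (\<rho> j))"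
    using le Suc.prems(1) i(1) by (intro ennreal_leI) (simp add: sum.remove[of A i] \<sigma>_def)
  also have "\<dots> = ennreal (\<Sum>l\<in>A - {i}. cmod (x l) * w (\<sigma> l)) + ennreal (cmod (x i)) * ennreal (w (\<rho> j))"
    by (simp add: w(2) sum_nonneg ennreal_mult)
  also have "\<dots> \<le> (\<Sum>k<N. decr I x k * ennreal (w k)) + decr I x N * ennreal (w N)"
    using IH xi antimonoD[OF w(1) \<open>N \<le> \<rho> j\<close>] by (intro add_mono mult_mono ennreal_leI) auto
  finally show ?case by (simp add: Suc.hyps(2)[symmetric])
qed

lemma weighted_sum_le_lorentz:
  assumes "antimono w" "\<And>k. 0 \<le> w k" "finite A" "A \<subseteq> I" "inj_on \<rho> A"
  shows "ennreal (\<Sum>i\<in>A. cmod (x i) * w (\<rho> i)) \<le> (\<Sum>k. decr I x k * ennreal (w k))"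
  using weighted_sum_le_decr[OF assms, of x] sum_le_suminf[of "\<lambda>k. decr I x k * ennreal (w k)" "{..<card A}"]
  by (auto intro: order_trans)

text \<open>Position \<open>k\<close> offers \<open>Suc k\<close> candidates and the earlier
  positions have used at most \<open>k\<close>, so distinct witnesses can be picked in turn.
  \<open>F\<close> allows positions to be skipped: where the rearrangement vanishes, no strict lower
  bound exists.\<close>

lemma greedy_witnesses:
  assumes "\<And>k. k \<in> F \<Longrightarrow> k < K \<Longrightarrow> s k < decr I x k"
  shows "\<exists>e. inj_on e (F \<inter> {..<K}) \<and> (\<forall>k\<in>F \<inter> {..<K}. e k \<in> I \<and> s k < ennreal (cmod (x (e k))))"
  using assms
proof (induction K)
  case 0
  then show ?case by auto
next
  case (Suc K)
  then obtain e where e: "inj_on e (F \<inter> {..<K})"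
    "\<forall>k\<in>F \<inter> {..<K}. e k \<in> I \<and> s k < ennreal (cmod (x (e k)))"
    by (meson less_SucI)
  show ?case
  proof (cases "K \<in> F")
    case False
    then have "F \<inter> {..<Suc K} = F \<inter> {..<K}" by (auto simp: less_Suc_eq)
    then show ?thesis using e by auto
  next
    case True
    then have "s K < decr I x K" using Suc.prems by simp
    then obtain B where B: "B \<subseteq> I" "finite B" "card B = Suc K" "\<forall>i\<in>B. s K < ennreal (cmod (x i))"
      unfolding less_decr_iff by blast
    have "card (e ` (F \<inter> {..<K})) \<le> card (F \<inter> {..<K})" by (rule card_image_le) auto
    also have "\<dots> \<le> K" by (metis Int_lower2 card_lessThan card_mono finite_lessThan)
    finally have "\<not> B \<subseteq> e ` (F \<inter> {..<K})"
      using B(3) card_mono[of "e ` (F \<inter> {..<K})" B] by auto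
    then obtain b where b: "b \<in> B" "b \<notin> e ` (F \<inter> {..<K})" by auto
    have eq: "F \<inter> {..<Suc K} = insert K (F \<inter> {..<K})" using True by (auto simp: less_Suc_eq)
    have "inj_on (e(K := b)) (F \<inter> {..<Suc K})"
      unfolding eq using e(1) b(2) by (auto simp: inj_on_def)
    moreover have "\<forall>k\<in>F \<inter> {..<Suc K}. (e(K := b)) k \<in> I \<and> s k < ennreal (cmod (x ((e(K := b)) k)))"
      unfolding eq using e(2) b(1) B by auto
    ultimately show ?thesis by blast
  qed
qed

text \<open>Converse of \<open>weighted_sum_le_lorentz\<close>. Singletons at rank 0 bound all
  entries, because \<open>w 0 > 0\<close>, so the rearrangement is finite; witnesses for its values
  then form a test set.\<close>

lemma lorentz_leI:
  fixes x :: "'i \<Rightarrow> complex" and w :: "nat \<Rightarrow> real"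
  assumes w: "w 0 > 0" "\<And>k. 0 \<le> w k"
    and L: "\<And>A \<rho>. finite A \<Longrightarrow> A \<subseteq> I \<Longrightarrow> inj_on \<rho> A \<Longrightarrow>
              ennreal (\<Sum>i\<in>A. cmod (x i) * w (\<rho> i)) \<le> L"
  shows "(\<Sum>k. decr I x k * ennreal (w k)) \<le> L"
proof (cases "L = top")
  case True then show ?thesis by simp
next
  case False
  then obtain l where l: "L = ennreal l" "0 \<le> l" by (cases L) auto
  have bd: "cmod (x i) \<le> l / w 0" if "i \<in> I" for i
  proof -
    have "ennreal (cmod (x i) * w 0) \<le> ennreal l"
      using L[of "{i}" "\<lambda>_. 0"] that l by simp
    then show ?thesis using w(1) l by (simp add: pos_le_divide_eq ennreal_le_iff)
  qed
  define d where "d k = enn2real (decr I x k)" for k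
  have d: "decr I x k = ennreal (d k)" "0 \<le> d k" for k
    using decr_less_top[of I x "l / w 0" k] bd by (auto simp: d_def)
  show ?thesis
  proof (rule suminf_le_const[OF summableI])
    fix K
    have "(\<Sum>k<K. d k * w k) \<le> l"
    \<comment> \<open>Over an infinite index set a value of the rearrangement need not be attained,
      so entries above \<open>c\<close> times it are used, for every \<open>c < 1\<close>.\<close>
    proof (rule field_le_mult_one_interval)
      fix c :: real assume c: "0 < c" "c < 1"
      let ?F = "{k. 0 < d k} \<inter> {..<K}"
      have "\<exists>e. inj_on e ?F \<and> (\<forall>k\<in>?F. e k \<in> I \<and> ennreal (c * d k) < ennreal (cmod (x (e k))))"
        by (rule greedy_witnesses) (use c in \<open>auto simp: d(1) ennreal_less_iff\<close>)
      then obtain e where e: "inj_on e ?F" "\<And>k. k \<in> ?F \<Longrightarrow> e k \<in> I"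
        "\<And>k. k \<in> ?F \<Longrightarrow> ennreal (c * d k) < ennreal (cmod (x (e k)))" by auto
      have "c * (\<Sum>k<K. d k * w k) = c * (\<Sum>k\<in>?F. d k * w k)"
        using d(2) by (intro arg_cong[where f = "(*) c"] sum.mono_neutral_right)
          (auto simp: not_less intro: antisym)
      also have "\<dots> = (\<Sum>k\<in>?F. c * d k * w k)" by (simp add: sum_distrib_left mult.assoc)
      also have "\<dots> \<le> (\<Sum>k\<in>?F. cmod (x (e k)) * w k)"
        using e(3) c d(2) w(2) by (intro sum_mono mult_right_mono) (auto simp: ennreal_less_iff less_imp_le)
      also have "\<dots> = (\<Sum>i\<in>e ` ?F. cmod (x i) * w (the_inv_into ?F e i))"
        by (simp add: sum.reindex[OF e(1)] the_inv_into_f_f[OF e(1)])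
      also have "\<dots> \<le> l"
        using L[of "e ` ?F" "the_inv_into ?F e"] e(2) l inj_on_the_inv_into[OF e(1)]
        by (auto simp: ennreal_le_iff)
      finally show "c * (\<Sum>k<K. d k * w k) \<le> l" .
    qed
    then show "(\<Sum>k<K. decr I x k * ennreal (w k)) \<le> L"
      by (simp add: d l w(2) ennreal_mult[symmetric] sum_ennreal ennreal_leI)
  qed
qed

section \<open>Increments of fractional powers\<close>

lemma powr_increment:
  assumes s: "0 < s" "s \<le> 1"
  obtains z where "real k < z" "z < real (Suc k)"
    "real (Suc k) powr s - real k powr s = s * z powr (s - 1)"
proof -
  \<comment> \<open>The intermediate point is strictly inside, which avoids the origin, where the
    power is not differentiable for \<open>s < 1\<close>.\<close>
  have "\<exists>l z. real k < z \<and> z < real (Suc k) \<and>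
      DERIV (\<lambda>x. x powr s) z :> l \<and> real (Suc k) powr s - real k powr s = (real (Suc k) - real k) * l"
  proof (rule MVT)
    show "continuous_on {real k..real (Suc k)} (\<lambda>x. x powr s)"
      using s by (intro continuous_on_powr' continuous_intros) auto
    show "(\<lambda>x. x powr s) differentiable (at x)" if "real k < x" for x
      using that has_real_derivative_powr[of x s] by (intro differentiableI) (auto simp: has_field_derivative_def)
  qed auto
  then obtain l z where z: "real k < z" "z < real (Suc k)" "DERIV (\<lambda>x. x powr s) z :> l"
    "real (Suc k) powr s - real k powr s = l"
    by auto
  have "0 < z" using z(1) by linarith
  then have "DERIV (\<lambda>x. x powr s) z :> s * z powr (s - 1)"
    by (rule has_real_derivative_powr)
  then have "l = s * z powr (s - 1)" using z(3) DERIV_unique by blast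
  then show ?thesis using that z by blast
qed

lemma powr_increment_ge:
  assumes "0 < s" "s \<le> 1"
  shows "s * real (Suc k) powr (s - 1) \<le> real (Suc k) powr s - real k powr s"
proof -
  obtain z where z: "real k < z" "z < real (Suc k)"
    "real (Suc k) powr s - real k powr s = s * z powr (s - 1)"
    using powr_increment[OF assms] .
  have "real (Suc k) powr (s - 1) \<le> z powr (s - 1)"
    using z assms by (intro powr_mono2') auto
  then show ?thesis using z(3) assms by (simp add: mult_left_mono)
qed

text \<open>The intermediate point of the mean value theorem lies below \<open>Suc k\<close>, where
  the derivative is larger, so the bound comes instead from
  \<open>k (k+1)^(s-1) <= k^s\<close>.\<close>

lemma powr_increment_le:
  assumes "0 < s" "s \<le> 1"
  shows "real (Suc k) powr s - real k powr s \<le> real (Suc k) powr (s - 1)"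
proof (cases "k = 0")
  case False
  have "real k * real (Suc k) powr (s - 1) \<le> real k * real k powr (s - 1)"
    using assms False by (intro mult_left_mono powr_mono2') auto
  moreover have "real k * real k powr (s - 1) = real k powr s"
    using False by (simp add: powr_mult_base)
  moreover have "real (Suc k) powr s = real (Suc k) * real (Suc k) powr (s - 1)"
    by (simp add: powr_mult_base)
  ultimately show ?thesis by (simp add: algebra_simps)
qed simp

lemma antimono_powr_increment:
  assumes "0 < s" "s \<le> 1"
  shows "antimono (\<lambda>k. real (Suc k) powr s - real k powr s)"
proof (rule antimonoI, rule lift_Suc_antimono_le)
  fix k
  obtain z where z: "real k < z" "z < real (Suc k)"
    "real (Suc k) powr s - real k powr s = s * z powr (s - 1)"
    using powr_increment[OF assms] .
  obtain y where y: "real (Suc k) < y" "y < real (Suc (Suc k))"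
    "real (Suc (Suc k)) powr s - real (Suc k) powr s = s * y powr (s - 1)"
    using powr_increment[OF assms] .
  have "y powr (s - 1) \<le> z powr (s - 1)"
    using z y assms by (intro powr_mono2') auto
  then show "real (Suc (Suc k)) powr s - real (Suc k) powr s \<le> real (Suc k) powr s - real k powr s"
    using z(3) y(3) assms by (simp add: mult_left_mono)
qed

lemma powr_increment_nonneg: "0 < s \<Longrightarrow> 0 \<le> real (Suc k) powr s - real k powr s"
  by (simp add: powr_mono2)

lemma sum_powr_increment: "(\<Sum>k<K. real (Suc k) powr s - real k powr s) = real K powr s"
  by (subst sum_lessThan_telescope) simp

section \<open>The Lorentz space\<close>

definition lorentz_weight :: "real \<Rightarrow> nat \<Rightarrow> real" where
  "lorentz_weight p k = real (Suc k) powr (1/p) - real k powr (1/p)"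

context
  fixes p :: real
  assumes p: "1 \<le> p"
begin

lemma lorentz_weight_0 [simp]: "lorentz_weight p 0 = 1"
  by (simp add: lorentz_weight_def)

lemma lorentz_weight_nonneg: "0 \<le> lorentz_weight p k"
  using p powr_increment_nonneg[of "1/p" k] by (simp add: lorentz_weight_def)

lemma antimono_lorentz_weight: "antimono (lorentz_weight p)"
  using p antimono_powr_increment[of "1/p"] by (simp add: lorentz_weight_def [abs_def])

lemma lorentz_p1_norm_eq: "lorentz_p1_norm p x = (\<Sum>k. decr UNIV x k * ennreal (lorentz_weight p k))"
  by (simp add: lorentz_p1_norm_def lorentz_weight_def)

text \<open>With \<open>lorentz_p1_norm_leI\<close> this exhibits the norm as a supremum of finite
  weighted \<open>l1\<close> sums. Solidity, subadditivity and lower semicontinuity then become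
  termwise statements, although rearrangement itself is not additive.\<close>

lemma lorentz_p1_norm_ge:
  assumes "finite A" "inj_on \<rho> A"
  shows "ennreal (\<Sum>i\<in>A. cmod (x i) * lorentz_weight p (\<rho> i)) \<le> lorentz_p1_norm p x"
  unfolding lorentz_p1_norm_eq using assms
  by (intro weighted_sum_le_lorentz antimono_lorentz_weight lorentz_weight_nonneg) auto

lemma lorentz_p1_norm_leI:
  assumes "\<And>A \<rho>. finite A \<Longrightarrow> inj_on \<rho> A \<Longrightarrow> ennreal (\<Sum>i\<in>A. cmod (x i) * lorentz_weight p (\<rho> i)) \<le> L"
  shows "lorentz_p1_norm p x \<le> L"
  unfolding lorentz_p1_norm_eq using assms
  by (intro lorentz_leI lorentz_weight_nonneg) auto

lemma lorentz_weighted_sum_nonneg: "0 \<le> (\<Sum>i\<in>A. cmod (x i) * lorentz_weight p (\<rho> i))"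
  by (intro sum_nonneg mult_nonneg_nonneg lorentz_weight_nonneg) auto

lemma lorentz_p1_norm_mono:
  assumes "\<And>i. cmod (y i) \<le> cmod (x i)"
  shows "lorentz_p1_norm p y \<le> lorentz_p1_norm p x"
proof (rule lorentz_p1_norm_leI)
  fix A :: "nat set" and \<rho> :: "nat \<Rightarrow> nat" assume A: "finite A" "inj_on \<rho> A"
  have "(\<Sum>i\<in>A. cmod (y i) * lorentz_weight p (\<rho> i)) \<le> (\<Sum>i\<in>A. cmod (x i) * lorentz_weight p (\<rho> i))"
    using assms by (intro sum_mono mult_right_mono lorentz_weight_nonneg) auto
  then show "ennreal (\<Sum>i\<in>A. cmod (y i) * lorentz_weight p (\<rho> i)) \<le> lorentz_p1_norm p x"
    using lorentz_p1_norm_ge[OF A] by (meson ennreal_leI order_trans)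
qed

lemma lorentz_p1_norm_triangle:
  "lorentz_p1_norm p (\<lambda>i. x i + y i) \<le> lorentz_p1_norm p x + lorentz_p1_norm p y"
proof (rule lorentz_p1_norm_leI)
  fix A :: "nat set" and \<rho> :: "nat \<Rightarrow> nat" assume A: "finite A" "inj_on \<rho> A"
  have "(\<Sum>i\<in>A. cmod (x i + y i) * lorentz_weight p (\<rho> i))
      \<le> (\<Sum>i\<in>A. (cmod (x i) + cmod (y i)) * lorentz_weight p (\<rho> i))"
    by (intro sum_mono mult_right_mono lorentz_weight_nonneg norm_triangle_ineq)
  also have "\<dots> = (\<Sum>i\<in>A. cmod (x i) * lorentz_weight p (\<rho> i)) + (\<Sum>i\<in>A. cmod (y i) * lorentz_weight p (\<rho> i))"
    by (simp only: distrib_right sum.distrib)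
  finally have "ennreal (\<Sum>i\<in>A. cmod (x i + y i) * lorentz_weight p (\<rho> i))
      \<le> ennreal (\<Sum>i\<in>A. cmod (x i) * lorentz_weight p (\<rho> i)) + ennreal (\<Sum>i\<in>A. cmod (y i) * lorentz_weight p (\<rho> i))"
    using lorentz_weighted_sum_nonneg[where A = A and \<rho> = \<rho> and x = x]
      lorentz_weighted_sum_nonneg[where A = A and \<rho> = \<rho> and x = y]
    by (simp add: ennreal_leI flip: ennreal_plus)
  then show "ennreal (\<Sum>i\<in>A. cmod (x i + y i) * lorentz_weight p (\<rho> i)) \<le> lorentz_p1_norm p x + lorentz_p1_norm p y"
    using add_mono[OF lorentz_p1_norm_ge[OF A] lorentz_p1_norm_ge[OF A]] by (meson order_trans)
qed

lemma lorentz_p1_norm_scale_le: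
  "lorentz_p1_norm p (\<lambda>i. c * x i) \<le> ennreal (cmod c) * lorentz_p1_norm p x"
proof (rule lorentz_p1_norm_leI)
  fix A :: "nat set" and \<rho> :: "nat \<Rightarrow> nat" assume A: "finite A" "inj_on \<rho> A"
  have "(\<Sum>i\<in>A. cmod (c * x i) * lorentz_weight p (\<rho> i)) = cmod c * (\<Sum>i\<in>A. cmod (x i) * lorentz_weight p (\<rho> i))"
    by (simp only: norm_mult sum_distrib_left mult.assoc)
  then have "ennreal (\<Sum>i\<in>A. cmod (c * x i) * lorentz_weight p (\<rho> i))
      = ennreal (cmod c) * ennreal (\<Sum>i\<in>A. cmod (x i) * lorentz_weight p (\<rho> i))"
    using ennreal_mult[OF norm_ge_zero lorentz_weighted_sum_nonneg] by simp
  then show "ennreal (\<Sum>i\<in>A. cmod (c * x i) * lorentz_weight p (\<rho> i)) \<le> ennreal (cmod c) * lorentz_p1_norm p x"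
    using mult_left_mono[OF lorentz_p1_norm_ge[OF A], of "ennreal (cmod c)"] by simp
qed

lemma lorentz_p1_norm_scale:
  "lorentz_p1_norm p (\<lambda>i. c * x i) = ennreal (cmod c) * lorentz_p1_norm p x"
proof (rule antisym[OF lorentz_p1_norm_scale_le])
  show "ennreal (cmod c) * lorentz_p1_norm p x \<le> lorentz_p1_norm p (\<lambda>i. c * x i)"
  proof (cases "c = 0")
    case False
    have "lorentz_p1_norm p x = lorentz_p1_norm p (\<lambda>i. (1/c) * (c * x i))"
      using False by simp
    also have "\<dots> \<le> ennreal (cmod (1/c)) * lorentz_p1_norm p (\<lambda>i. c * x i)"
      by (rule lorentz_p1_norm_scale_le)
    finally have "ennreal (cmod c) * lorentz_p1_norm p x
        \<le> ennreal (cmod c) * (ennreal (cmod (1/c)) * lorentz_p1_norm p (\<lambda>i. c * x i))"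
      by (rule mult_left_mono) simp
    also have "\<dots> = lorentz_p1_norm p (\<lambda>i. c * x i)"
      using False by (simp add: mult.assoc[symmetric] ennreal_mult[symmetric] norm_divide)
    finally show ?thesis .
  qed simp
qed

lemma cmod_le_lorentz_p1_norm: "ennreal (cmod (x i)) \<le> lorentz_p1_norm p x"
  using lorentz_p1_norm_ge[of "{i}" "\<lambda>_. 0" x] by simp

lemma lorentz_p1_norm_eq_0_iff: "lorentz_p1_norm p x = 0 \<longleftrightarrow> x = (\<lambda>_. 0)"
proof
  assume "lorentz_p1_norm p x = 0"
  then have "ennreal (cmod (x i)) \<le> 0" for i using cmod_le_lorentz_p1_norm[of x i] by simp
  then show "x = (\<lambda>_. 0)" by (auto simp: ennreal_eq_0_iff)
next
  assume "x = (\<lambda>_. 0)"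
  then have "lorentz_p1_norm p x \<le> 0" by (intro lorentz_p1_norm_leI) simp
  then show "lorentz_p1_norm p x = 0" by simp
qed

lemma decr_equidistributed:
  assumes "equidistributed x y"
  shows "decr UNIV x = decr UNIV y"
proof -
  have "finite {i. t < ennreal (cmod (x i))} = finite {i. t < ennreal (cmod (y i))}
     \<and> card {i. t < ennreal (cmod (x i))} = card {i. t < ennreal (cmod (y i))}" for t
  proof (cases t)
    case (real r)
    then show ?thesis using assms by (simp add: equidistributed_def ennreal_less_iff)
  qed simp
  then show ?thesis by (simp add: decr_def fun_eq_iff)
qed

text \<open>Fatou property: each finite test sum is continuous under coordinatewise
  convergence.\<close>

lemma lorentz_p1_norm_limit_le:
  assumes e: "0 \<le> e" and lim: "\<And>i. (\<lambda>n. f n i) \<longlonglongrightarrow> x i"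
    and le: "eventually (\<lambda>n. lorentz_p1_norm p (f n) \<le> ennreal e) sequentially"
  shows "lorentz_p1_norm p x \<le> ennreal e"
proof (rule lorentz_p1_norm_leI, rule ennreal_leI)
  fix A :: "nat set" and \<rho> :: "nat \<Rightarrow> nat" assume A: "finite A" "inj_on \<rho> A"
  show "(\<Sum>i\<in>A. cmod (x i) * lorentz_weight p (\<rho> i)) \<le> e"
  proof (rule tendsto_upperbound)
    show "(\<lambda>n. \<Sum>i\<in>A. cmod (f n i) * lorentz_weight p (\<rho> i)) \<longlonglongrightarrow> (\<Sum>i\<in>A. cmod (x i) * lorentz_weight p (\<rho> i))"
      by (intro tendsto_intros lim)
    have "(\<Sum>i\<in>A. cmod (f n i) * lorentz_weight p (\<rho> i)) \<le> e" if "lorentz_p1_norm p (f n) \<le> ennreal e" for n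
      using order_trans[OF lorentz_p1_norm_ge[OF A, of "f n"] that] e by (subst (asm) ennreal_le_iff)
    then show "\<forall>\<^sub>F n in sequentially. (\<Sum>i\<in>A. cmod (f n i) * lorentz_weight p (\<rho> i)) \<le> e"
      using le by (auto elim: eventually_mono)
  qed simp
qed

lemma lorentz_p1_complete:
  fixes f :: "nat \<Rightarrow> seq"
  assumes f: "\<And>n. lorentz_p1_norm p (f n) < top"
    and cauchy: "\<And>e. e > 0 \<Longrightarrow> \<exists>M. \<forall>n\<ge>M. \<forall>k\<ge>M. enn2real (lorentz_p1_norm p (\<lambda>i. f n i - f k i)) < e"
  shows "\<exists>x. lorentz_p1_norm p x < top \<and>
    (\<forall>e>0. \<exists>M. \<forall>n\<ge>M. enn2real (lorentz_p1_norm p (\<lambda>i. f n i - x i)) < e)"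
proof -
  \<comment> \<open>Since \<open>enn2real\<close> sends infinity to 0, the Cauchy hypothesis carries
    information only once the norms of the differences are known to be finite.\<close>
  have fin: "lorentz_p1_norm p (\<lambda>i. f n i - f k i) < top" for n k
  proof -
    have "lorentz_p1_norm p (\<lambda>i. f n i - f k i) \<le> lorentz_p1_norm p (f n) + lorentz_p1_norm p (\<lambda>i. (-1) * f k i)"
      using lorentz_p1_norm_triangle[of "f n" "\<lambda>i. (-1) * f k i"] by simp
    also have "\<dots> < top" unfolding lorentz_p1_norm_scale using f by (simp add: ennreal_add_less_top)
    finally show ?thesis .
  qed
  have cauchy': "\<exists>M. \<forall>n\<ge>M. \<forall>k\<ge>M. lorentz_p1_norm p (\<lambda>i. f n i - f k i) \<le> ennreal e" if e: "0 < e" for e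
  proof -
    obtain M where "\<forall>n\<ge>M. \<forall>k\<ge>M. enn2real (lorentz_p1_norm p (\<lambda>i. f n i - f k i)) < e"
      using cauchy[OF e] by blast
    then show ?thesis using fin
      by (metis enn2real_nonneg ennreal_enn2real ennreal_leI less_imp_le)
  qed
  have "\<exists>l. (\<lambda>n. f n i) \<longlonglongrightarrow> l" for i
  proof (rule Cauchy_convergent[unfolded convergent_def], rule metric_CauchyI)
    fix e :: real assume "0 < e"
    then obtain M where M: "\<forall>n\<ge>M. \<forall>k\<ge>M. lorentz_p1_norm p (\<lambda>i. f n i - f k i) \<le> ennreal (e/2)"
      using cauchy'[of "e/2"] by auto
    have "dist (f n i) (f k i) < e" if "n \<ge> M" "k \<ge> M" for n k
    proof -
      have "ennreal (cmod (f n i - f k i)) \<le> ennreal (e/2)"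
        using cmod_le_lorentz_p1_norm[of "\<lambda>i. f n i - f k i" i] M that by (meson order_trans)
      then show ?thesis using \<open>0 < e\<close> by (simp add: dist_norm ennreal_le_iff)
    qed
    then show "\<exists>M. \<forall>n\<ge>M. \<forall>k\<ge>M. dist (f n i) (f k i) < e" by blast
  qed
  then obtain x where x: "\<And>i. (\<lambda>n. f n i) \<longlonglongrightarrow> x i" by metis
  have conv: "\<exists>M. \<forall>n\<ge>M. lorentz_p1_norm p (\<lambda>i. f n i - x i) \<le> ennreal e" if e: "0 < e" for e
  proof -
    obtain M where M: "\<forall>n\<ge>M. \<forall>k\<ge>M. lorentz_p1_norm p (\<lambda>i. f n i - f k i) \<le> ennreal e"
      using cauchy'[OF e] by blast
    have "lorentz_p1_norm p (\<lambda>i. f n i - x i) \<le> ennreal e" if "n \<ge> M" for n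
    proof (rule lorentz_p1_norm_limit_le)
      show "(\<lambda>k. f n i - f k i) \<longlonglongrightarrow> f n i - x i" for i by (intro tendsto_intros x)
      show "0 \<le> e" using e by simp
      show "\<forall>\<^sub>F k in sequentially. lorentz_p1_norm p (\<lambda>i. f n i - f k i) \<le> ennreal e"
        using M that by (auto simp: eventually_sequentially)
    qed
    then show ?thesis by blast
  qed
  have "lorentz_p1_norm p x < top"
  proof -
    obtain n where n: "lorentz_p1_norm p (\<lambda>i. f n i - x i) \<le> ennreal 1"
      using conv[of 1] by auto
    have "lorentz_p1_norm p x \<le> lorentz_p1_norm p (f n) + lorentz_p1_norm p (\<lambda>i. (-1) * (f n i - x i))"
      using lorentz_p1_norm_triangle[of "f n" "\<lambda>i. (-1) * (f n i - x i)"] by simp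
    also have "\<dots> < top" unfolding lorentz_p1_norm_scale using f[of n] n
      by (simp add: ennreal_add_less_top) (metis ennreal_less_top ennreal_1 order_le_less_trans)
    finally show ?thesis .
  qed
  moreover have "\<exists>M. \<forall>n\<ge>M. enn2real (lorentz_p1_norm p (\<lambda>i. f n i - x i)) < e" if e: "0 < e" for e
  proof -
    obtain M where M: "\<forall>n\<ge>M. lorentz_p1_norm p (\<lambda>i. f n i - x i) \<le> ennreal (e/2)"
      using conv[of "e/2"] e by auto
    have "enn2real (lorentz_p1_norm p (\<lambda>i. f n i - x i)) \<le> e/2" if "n \<ge> M" for n
      using M that e by (intro enn2real_leI) auto
    moreover have "e / 2 < e" using e by simp
    ultimately show ?thesis by (meson order_le_less_trans)
  qed
  ultimately show ?thesis by blast
qed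

lemma sym_banach_lorentz_p1: "sym_banach_seq_space (lorentz_p1 p)"
  unfolding sym_banach_seq_space_def Let_def lorentz_p1_def fst_conv snd_conv mem_Collect_eq
proof (intro conjI ballI allI impI)
  show "lorentz_p1_norm p (\<lambda>_. 0) < top"
    using lorentz_p1_norm_eq_0_iff by (metis ennreal_zero_less_top)
next
  fix x y assume xy: "x \<in> {x. lorentz_p1_norm p x < top}" "y \<in> {x. lorentz_p1_norm p x < top}"
  have lt: "lorentz_p1_norm p x + lorentz_p1_norm p y < top" using xy by (simp add: ennreal_add_less_top)
  show "lorentz_p1_norm p (\<lambda>i. x i + y i) < top"
    using lorentz_p1_norm_triangle[of x y] lt by (rule order_le_less_trans)
  show "enn2real (lorentz_p1_norm p (\<lambda>i. x i + y i)) \<le> enn2real (lorentz_p1_norm p x) + enn2real (lorentz_p1_norm p y)"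
    using enn2real_mono[OF lorentz_p1_norm_triangle[of x y] lt] xy by (simp add: enn2real_plus)
next
  fix c :: complex and x assume x: "x \<in> {x. lorentz_p1_norm p x < top}"
  show "lorentz_p1_norm p (\<lambda>i. c * x i) < top"
    using x by (simp add: lorentz_p1_norm_scale ennreal_mult_less_top)
  show "enn2real (lorentz_p1_norm p (\<lambda>i. c * x i)) = cmod c * enn2real (lorentz_p1_norm p x)"
    by (simp add: lorentz_p1_norm_scale enn2real_mult)
next
  fix x assume x: "x \<in> {x. lorentz_p1_norm p x < top}"
  show "0 \<le> enn2real (lorentz_p1_norm p x)" by simp
  show "(enn2real (lorentz_p1_norm p x) = 0) = (x = (\<lambda>_. 0))"
    using x by (auto simp: enn2real_eq_0_iff lorentz_p1_norm_eq_0_iff)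
next
  fix x y assume x: "x \<in> {x. lorentz_p1_norm p x < top}" and le: "\<forall>i. cmod (y i) \<le> cmod (x i)"
  show "lorentz_p1_norm p y < top"
    using lorentz_p1_norm_mono[of y x] le x by (auto intro: order_le_less_trans)
  show "enn2real (lorentz_p1_norm p y) \<le> enn2real (lorentz_p1_norm p x)"
    using lorentz_p1_norm_mono[of y x] le x by (auto intro: enn2real_mono)
next
  fix f :: "nat \<Rightarrow> seq"
  assume "(\<forall>n. lorentz_p1_norm p (f n) < top) \<and>
    (\<forall>e>0. \<exists>M. \<forall>n\<ge>M. \<forall>k\<ge>M. enn2real (lorentz_p1_norm p (\<lambda>i. f n i - f k i)) < e)"
  then show "\<exists>x\<in>{x. lorentz_p1_norm p x < top}.
      \<forall>e>0. \<exists>M. \<forall>n\<ge>M. enn2real (lorentz_p1_norm p (\<lambda>i. f n i - x i)) < e"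
    using lorentz_p1_complete[of f] by auto
next
  fix x y assume x: "x \<in> {x. lorentz_p1_norm p x < top}" and "equidistributed x y"
  then have "lorentz_p1_norm p y = lorentz_p1_norm p x"
    by (simp add: lorentz_p1_norm_def decr_equidistributed)
  then show "lorentz_p1_norm p y < top" "enn2real (lorentz_p1_norm p y) = enn2real (lorentz_p1_norm p x)"
    using x by auto
qed

end

section \<open>Embedding into a symmetric sequence space\<close>

text \<open>The symmetry axiom of \<open>X\<close> is phrased through equidistribution; this lets
  membership and norm pass from the rearrangement back to the sequence itself.\<close>

lemma equidistributed_if_decr_eq:
  assumes "decr UNIV x = decr UNIV y"
  shows "equidistributed x y"
  unfolding equidistributed_def
proof (intro allI impI)
  have key: "finite {i. cmod (x i) > t} \<and> card {i. cmod (x i) > t} \<le> k \<longleftrightarrow> \<not> ennreal t < decr UNIV x k"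
    if "t \<ge> 0" for x :: seq and t k
  proof -
    have "ennreal t < decr UNIV x k \<longleftrightarrow> (\<exists>B\<subseteq>{i. cmod (x i) > t}. finite B \<and> card B = Suc k)"
      unfolding less_decr_iff using that by (auto simp: ennreal_less_iff subset_iff)
    also have "\<dots> \<longleftrightarrow> \<not> (finite {i. cmod (x i) > t} \<and> card {i. cmod (x i) > t} \<le> k)" (is "?L = ?R")
    proof
      assume ?L
      then show ?R by (metis card_mono not_less_eq_eq)
    next
      assume R: ?R
      show ?L
      proof (cases "finite {i. cmod (x i) > t}")
        case True
        with R have "Suc k \<le> card {i. cmod (x i) > t}" by simp
        then obtain B where "B \<subseteq> {i. cmod (x i) > t}" "card B = Suc k" "finite B" by (rule obtain_subset_with_card_n)
        then show ?thesis by blast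
      next
        case False
        then show ?thesis using infinite_arbitrarily_large by blast
      qed
    qed
    finally show ?thesis by blast
  qed
  fix t :: real assume t: "0 \<le> t"
  let ?A = "{i. cmod (x i) > t}" and ?B = "{i. cmod (y i) > t}"
  have iff: "finite ?A \<and> card ?A \<le> k \<longleftrightarrow> finite ?B \<and> card ?B \<le> k" for k
    using key[OF t, of x] key[OF t, of y] assms by simp
  then have "finite ?A \<longleftrightarrow> finite ?B" by blast
  \<comment> \<open>In the infinite case both cardinalities are 0 by convention.\<close>
  moreover have "card ?A = card ?B"
    using iff[of "card ?A"] iff[of "card ?B"] by (metis card.infinite le_antisym le_refl)
  ultimately show "(finite ?A \<longleftrightarrow> finite ?B) \<and> card ?A = card ?B" by blast
qed

text \<open>The norms of these sequences form the fundamental function of \<open>X\<close>, on whose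
  growth the embedding rests.\<close>

definition initial_indicator :: "nat \<Rightarrow> seq" where
  "initial_indicator n = (\<lambda>i. if i < n then 1 else 0)"

context
  fixes X :: seqspace
  assumes X: "sym_banach_seq_space X"
begin

lemmas sbs_axioms = X[unfolded sym_banach_seq_space_def Let_def]

lemma sbs_zero: "(\<lambda>_. 0) \<in> fst X"
  using sbs_axioms[THEN conjunct1] by blast

lemma sbs_add: "x \<in> fst X \<Longrightarrow> y \<in> fst X \<Longrightarrow> (\<lambda>i. x i + y i) \<in> fst X"
  using sbs_axioms[THEN conjunct2, THEN conjunct1] by blast

lemma sbs_scale: "x \<in> fst X \<Longrightarrow> (\<lambda>i. c * x i) \<in> fst X"
  using sbs_axioms[THEN conjunct2, THEN conjunct2, THEN conjunct1] by blast

lemma sbs_norm_nonneg: "x \<in> fst X \<Longrightarrow> 0 \<le> snd X x"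
  using sbs_axioms[THEN conjunct2, THEN conjunct2, THEN conjunct2, THEN conjunct1] by blast

lemma sbs_norm_eq_0: "x \<in> fst X \<Longrightarrow> snd X x = 0 \<longleftrightarrow> x = (\<lambda>_. 0)"
  using sbs_axioms[THEN conjunct2, THEN conjunct2, THEN conjunct2, THEN conjunct1] by blast

lemma sbs_norm_scale: "x \<in> fst X \<Longrightarrow> snd X (\<lambda>i. c * x i) = cmod c * snd X x"
  using sbs_axioms[THEN conjunct2, THEN conjunct2, THEN conjunct2, THEN conjunct2, THEN conjunct1] by blast

lemma sbs_norm_triangle: "x \<in> fst X \<Longrightarrow> y \<in> fst X \<Longrightarrow> snd X (\<lambda>i. x i + y i) \<le> snd X x + snd X y"
  using sbs_axioms[THEN conjunct2, THEN conjunct2, THEN conjunct2, THEN conjunct2, THEN conjunct2, THEN conjunct1] by blast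

lemma sbs_solid: "x \<in> fst X \<Longrightarrow> (\<And>i. cmod (y i) \<le> cmod (x i)) \<Longrightarrow> y \<in> fst X"
  using sbs_axioms[THEN conjunct2, THEN conjunct2, THEN conjunct2, THEN conjunct2, THEN conjunct2, THEN conjunct2, THEN conjunct1] by blast

lemma sbs_norm_mono: "x \<in> fst X \<Longrightarrow> (\<And>i. cmod (y i) \<le> cmod (x i)) \<Longrightarrow> snd X y \<le> snd X x"
  using sbs_axioms[THEN conjunct2, THEN conjunct2, THEN conjunct2, THEN conjunct2, THEN conjunct2, THEN conjunct2, THEN conjunct1] by blast

lemma sbs_symmetric: "x \<in> fst X \<Longrightarrow> equidistributed x y \<Longrightarrow> y \<in> fst X"
  using sbs_axioms[THEN conjunct2, THEN conjunct2, THEN conjunct2, THEN conjunct2, THEN conjunct2, THEN conjunct2, THEN conjunct2, THEN conjunct2] by blast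

lemma sbs_norm_symmetric: "x \<in> fst X \<Longrightarrow> equidistributed x y \<Longrightarrow> snd X y = snd X x"
  using sbs_axioms[THEN conjunct2, THEN conjunct2, THEN conjunct2, THEN conjunct2, THEN conjunct2, THEN conjunct2, THEN conjunct2, THEN conjunct2] by blast

lemma sbs_complete:
  fixes f :: "nat \<Rightarrow> seq"
  assumes "\<And>n. f n \<in> fst X"
    and "\<And>e. e > 0 \<Longrightarrow> \<exists>M. \<forall>n\<ge>M. \<forall>k\<ge>M. snd X (\<lambda>i. f n i - f k i) < e"
  obtains x where "x \<in> fst X" "\<And>e. e > 0 \<Longrightarrow> \<exists>M. \<forall>n\<ge>M. snd X (\<lambda>i. f n i - x i) < e"
proof -
  have "\<exists>x\<in>fst X. \<forall>e>0. \<exists>M. \<forall>n\<ge>M. snd X (\<lambda>i. f n i - x i) < e"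
    by (rule sbs_axioms[THEN conjunct2, THEN conjunct2, THEN conjunct2, THEN conjunct2, THEN conjunct2, THEN conjunct2, THEN conjunct2, THEN conjunct1, THEN spec[of _ f], THEN mp]) (use assms in blast)
  then show ?thesis using that by blast
qed

lemma sbs_diff: "x \<in> fst X \<Longrightarrow> y \<in> fst X \<Longrightarrow> (\<lambda>i. x i - y i) \<in> fst X"
  using sbs_add[of x "\<lambda>i. (-1) * y i"] sbs_scale[of y "-1"] by simp

lemma sbs_norm_minus_commute:
  assumes "(\<lambda>i. x i - y i) \<in> fst X"
  shows "snd X (\<lambda>i. y i - x i) = snd X (\<lambda>i. x i - y i)"
  using sbs_norm_scale[OF assms, of "-1"] by simp

lemma sbs_unit:
  assumes "initial_indicator 1 \<in> fst X"
  shows "(\<lambda>j. if j = i then 1 else 0) \<in> fst X"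
    and "snd X (\<lambda>j. if j = i then 1 else 0) = snd X (initial_indicator 1)"
    and "0 < snd X (initial_indicator 1)"
proof -
  have "equidistributed (initial_indicator 1) (\<lambda>j. if j = i then 1 else 0)"
    unfolding equidistributed_def
  proof (intro allI impI)
    fix t :: real assume "0 \<le> t"
    have "{j. t < cmod (initial_indicator 1 j)} = (if t < 1 then {0} else {})"
      "{j. t < cmod (if j = i then 1 else 0)} = (if t < 1 then {i} else {})"
      using \<open>0 \<le> t\<close> by (auto simp: initial_indicator_def split: if_splits)
    then show "finite {j. t < cmod (initial_indicator 1 j)} = finite {j. t < cmod (if j = i then 1 else 0)} \<and>
      card {j. t < cmod (initial_indicator 1 j)} = card {j. t < cmod (if j = i then 1 else 0)}"
      by simp
  qed
  then show "(\<lambda>j. if j = i then 1 else 0) \<in> fst X"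
    "snd X (\<lambda>j. if j = i then 1 else 0) = snd X (initial_indicator 1)"
    using assms sbs_symmetric sbs_norm_symmetric by blast+
  have "initial_indicator 1 \<noteq> (\<lambda>_. 0)"
    by (auto simp: initial_indicator_def fun_eq_iff)
  then show "0 < snd X (initial_indicator 1)"
    using sbs_norm_nonneg[OF assms] sbs_norm_eq_0[OF assms] by linarith
qed

text \<open>All unit vectors have the same norm, so solidity makes norm convergence imply
  coordinatewise convergence. This identifies the limits that completeness supplies.\<close>

lemma sbs_coordinate_le:
  assumes "initial_indicator 1 \<in> fst X" "x \<in> fst X"
  shows "cmod (x i) * snd X (initial_indicator 1) \<le> snd X x"
proof -
  have "snd X (\<lambda>j. x i * (if j = i then 1 else 0)) \<le> snd X x"
    by (rule sbs_norm_mono[OF assms(2)]) auto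
  then show ?thesis
    using sbs_norm_scale[OF sbs_unit(1)[OF assms(1), of i], of "x i"] sbs_unit(2)[OF assms(1), of i] by simp
qed

text \<open>The axioms of \<open>X\<close> contain no Fatou property, so norm-bounded truncations
  would not place the rearrangement in \<open>X\<close>. It is obtained as a norm limit of a Cauchy
  sequence, and its coordinates are identified afterwards.\<close>

lemma embeds_lorentz_p1:
  fixes p C :: real
  assumes p: "1 \<le> p" and C: "0 < C"
    and ind: "\<And>n. initial_indicator n \<in> fst X"
    and fund: "\<And>n. snd X (initial_indicator n) \<le> C * real n powr (1/p)"
  shows "embeds (lorentz_p1 p) X"
  unfolding embeds_def
proof (intro exI[of _ C] conjI C ballI)
  fix x assume "x \<in> fst (lorentz_p1 p)"
  then have fin: "lorentz_p1_norm p x < top" by (simp add: lorentz_p1_def)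
  define l where "l = enn2real (lorentz_p1_norm p x)"
  have l: "lorentz_p1_norm p x = ennreal l" "0 \<le> l" using fin by (auto simp: l_def)
  define d where "d k = enn2real (decr UNIV x k)" for k
  let ?w = "lorentz_weight p"
  have decr: "decr UNIV x k = ennreal (d k)" for k
  proof -
    have "cmod (x i) \<le> l" for i
      using cmod_le_lorentz_p1_norm[OF p, of x i] l by (simp add: ennreal_le_iff)
    then have "decr UNIV x k < top" by (intro decr_less_top) auto
    then show ?thesis by (simp add: d_def)
  qed
  have d0: "0 \<le> d k" for k by (simp add: d_def)
  have d_mono: "d (Suc k) \<le> d k" for k
    using antimonoD[OF antimono_decr, of k "Suc k" UNIV x] d0 by (simp add: decr ennreal_le_iff)
  have partial: "(\<Sum>k<n. d k * ?w k) \<le> l" for n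
  proof -
    have "ennreal (\<Sum>k<n. d k * ?w k) = (\<Sum>k<n. decr UNIV x k * ennreal (?w k))"
      using lorentz_weight_nonneg[OF p] d0 by (simp add: decr ennreal_mult sum_ennreal flip: ennreal_mult)
    also have "\<dots> \<le> lorentz_p1_norm p x"
      unfolding lorentz_p1_norm_eq[OF p] by (rule sum_le_suminf) auto
    finally show ?thesis using l by (simp add: ennreal_le_iff)
  qed
  define \<sigma> where "\<sigma> n = (\<Sum>j<n. (d j - d (Suc j)) * real (Suc j) powr (1/p))" for n
  \<comment> \<open>Summation by parts. The boundary term is nonnegative, which bounds
    \<open>\<sigma>\<close>; its own bound also yields the decay of \<open>d\<close>.\<close>
  have abel: "\<sigma> n + d n * real n powr (1/p) = (\<Sum>k<n. d k * ?w k)" for n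
    by (induction n) (simp_all add: \<sigma>_def lorentz_weight_def algebra_simps)
  have \<sigma>_le: "\<sigma> n \<le> l" for n
    using abel[of n] partial[of n] d0[of n] by (smt (verit) mult_nonneg_nonneg powr_ge_zero)
  have \<sigma>_mono: "incseq \<sigma>"
    using d_mono by (intro incseq_SucI) (simp add: \<sigma>_def)
  have "convergent \<sigma>"
    using incseq_convergent[OF \<sigma>_mono] \<sigma>_le by (metis convergentI)
  then have \<sigma>_Cauchy: "Cauchy \<sigma>" by (rule convergent_Cauchy)
  have d_lim: "d \<longlonglongrightarrow> 0"
  proof (rule tendsto_sandwich[OF _ _ tendsto_const])
    show "\<forall>\<^sub>F n in sequentially. d n \<le> l * real n powr (- (1/p))"
      using eventually_gt_at_top[of 0]
    proof eventually_elim
      case (elim n)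
      have "0 \<le> \<sigma> n" unfolding \<sigma>_def using d_mono by (intro sum_nonneg) auto
      then have "d n * real n powr (1/p) \<le> l" using abel[of n] partial[of n] by linarith
      then show ?case using elim by (simp add: powr_minus field_simps)
    qed
    have "(\<lambda>n. real n powr (- (1/p))) \<longlonglongrightarrow> 0"
      using p by (intro tendsto_neg_powr filterlim_real_sequentially) auto
    then show "(\<lambda>n. l * real n powr (- (1/p))) \<longlonglongrightarrow> 0" by (rule tendsto_mult_right_zero)
  qed (use d0 in auto)

  \<comment> \<open>Lowering by \<open>d n\<close> before truncating makes each consecutive
    difference a multiple of a single indicator. The shift vanishes in the limit because
    \<open>d\<close> tends to 0.\<close>
  define f :: "nat \<Rightarrow> seq" where "f n = (\<lambda>i. if i < n then complex_of_real (d i - d n) else 0)" for n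
  have step: "f (Suc n) i - f n i = complex_of_real (d n - d (Suc n)) * initial_indicator (Suc n) i" for n i
    by (auto simp: f_def initial_indicator_def less_Suc_eq)
  have diff: "(\<lambda>i. f (n + r) i - f n i) \<in> fst X \<and> snd X (\<lambda>i. f (n + r) i - f n i) \<le> C * (\<sigma> (n + r) - \<sigma> n)" for n r
  proof (induction r)
    case 0
    then show ?case using sbs_zero sbs_norm_eq_0[OF sbs_zero] by simp
  next
    case (Suc r)
    let ?g = "\<lambda>i. complex_of_real (d (n + r) - d (Suc (n + r))) * initial_indicator (Suc (n + r)) i"
    have g: "?g \<in> fst X" by (rule sbs_scale[OF ind])
    have "snd X ?g = (d (n + r) - d (Suc (n + r))) * snd X (initial_indicator (Suc (n + r)))"
      using d_mono[of "n + r"] by (simp only: sbs_norm_scale[OF ind] norm_of_real)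
    also have "\<dots> \<le> (d (n + r) - d (Suc (n + r))) * (C * real (Suc (n + r)) powr (1/p))"
      using d_mono[of "n + r"] by (intro mult_left_mono fund) auto
    also have "\<dots> = C * (\<sigma> (Suc (n + r)) - \<sigma> (n + r))" by (simp add: \<sigma>_def)
    finally have "snd X ?g \<le> C * (\<sigma> (Suc (n + r)) - \<sigma> (n + r))" .
    moreover have eq: "(\<lambda>i. f (n + Suc r) i - f n i) = (\<lambda>i. (f (n + r) i - f n i) + ?g i)"
      using step[of "n + r"] by (auto simp: fun_eq_iff algebra_simps simp del: of_real_diff)
    ultimately show ?case
      using Suc sbs_add[of _ ?g] sbs_norm_triangle[of _ ?g] g unfolding eq
      by (force simp: algebra_simps)
  qed
  have f_in: "f n \<in> fst X" and f_norm: "snd X (f n) \<le> C * l" for n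
  proof -
    have eq: "(\<lambda>i. f (0 + n) i - f 0 i) = f n" by (auto simp: f_def)
    show "f n \<in> fst X" using diff[of 0 n] unfolding eq by blast
    have "snd X (f n) \<le> C * \<sigma> n" using diff[of 0 n] unfolding eq by (simp add: \<sigma>_def)
    also have "\<dots> \<le> C * l" using \<sigma>_le C by simp
    finally show "snd X (f n) \<le> C * l" .
  qed
  have le: "snd X (\<lambda>i. f n i - f k i) \<le> C * \<bar>\<sigma> n - \<sigma> k\<bar>" for n k
  proof (cases "k \<le> n")
    case True
    then show ?thesis using diff[of k "n - k"] incseqD[OF \<sigma>_mono True] by simp
  next
    case False
    then show ?thesis
      using diff[of n "k - n"] incseqD[OF \<sigma>_mono, of n k] sbs_norm_minus_commute[OF sbs_diff[OF f_in f_in], of k n]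
      by simp
  qed
  obtain z where z: "z \<in> fst X" "\<And>e. e > 0 \<Longrightarrow> \<exists>M. \<forall>n\<ge>M. snd X (\<lambda>i. f n i - z i) < e"
  proof (rule sbs_complete[OF f_in])
    fix e :: real assume "0 < e"
    then obtain M where M: "\<forall>n\<ge>M. \<forall>k\<ge>M. dist (\<sigma> n) (\<sigma> k) < e / C"
      using \<sigma>_Cauchy C unfolding Cauchy_def by (metis divide_pos_pos)
    have "snd X (\<lambda>i. f n i - f k i) < e" if "n \<ge> M" "k \<ge> M" for n k
    proof -
      have "C * \<bar>\<sigma> n - \<sigma> k\<bar> < e" using M that C by (simp add: dist_real_def field_simps)
      then show ?thesis using le[of n k] by linarith
    qed
    then show "\<exists>M. \<forall>n\<ge>M. \<forall>k\<ge>M. snd X (\<lambda>i. f n i - f k i) < e" by blast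
  qed (use that in blast)
  have fz: "(\<lambda>n. snd X (\<lambda>i. f n i - z i)) \<longlonglongrightarrow> 0"
    unfolding lim_sequentially using z(2) sbs_norm_nonneg[OF sbs_diff[OF f_in z(1)]] by (simp add: dist_real_def)
  have "z i = complex_of_real (d i)" for i
  proof (rule LIMSEQ_unique)
    have "(\<lambda>n. f n i - z i) \<longlonglongrightarrow> 0"
    proof (rule Lim_null_comparison)
      show "(\<lambda>n. snd X (\<lambda>i. f n i - z i) / snd X (initial_indicator 1)) \<longlonglongrightarrow> 0"
        using tendsto_divide_zero[OF fz] by simp
      show "\<forall>\<^sub>F n in sequentially. cmod (f n i - z i) \<le> snd X (\<lambda>i. f n i - z i) / snd X (initial_indicator 1)"
        using sbs_coordinate_le[OF ind sbs_diff[OF f_in z(1)]] sbs_unit(3)[OF ind] by (simp add: pos_le_divide_eq)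
    qed
    then show "(\<lambda>n. f n i) \<longlonglongrightarrow> z i" by (rule LIM_zero_cancel)
    have "(\<lambda>n. complex_of_real (d i - d n)) \<longlonglongrightarrow> complex_of_real (d i - 0)"
      by (intro tendsto_intros d_lim)
    moreover have "\<forall>\<^sub>F n in sequentially. complex_of_real (d i - d n) = f n i"
      using eventually_gt_at_top[of i] by eventually_elim (simp add: f_def)
    ultimately show "(\<lambda>n. f n i) \<longlonglongrightarrow> complex_of_real (d i)"
      using Lim_transform_eventually by simp
  qed
  then have z_eq: "z = fin_rearr UNIV x" by (simp add: fin_rearr_def d_def fun_eq_iff)
  have "snd X z \<le> C * l"
  proof (rule tendsto_lowerbound)
    show "(\<lambda>n. C * l + snd X (\<lambda>i. f n i - z i)) \<longlonglongrightarrow> C * l"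
      using tendsto_add[OF tendsto_const fz] by simp
    have "snd X z \<le> C * l + snd X (\<lambda>i. f n i - z i)" for n
      using sbs_norm_triangle[OF f_in[of n] sbs_diff[OF z(1) f_in[of n]]] f_norm[of n]
        sbs_norm_minus_commute[OF sbs_diff[OF f_in[of n] z(1)]] by simp
    then show "\<forall>\<^sub>F n in sequentially. snd X z \<le> C * l + snd X (\<lambda>i. f n i - z i)" by simp
  qed simp
  moreover have "equidistributed z x"
    unfolding z_eq by (intro equidistributed_if_decr_eq decr_rearrangement) (simp add: decr)
  ultimately show "x \<in> fst X" "snd X x \<le> C * snd (lorentz_p1 p) x"
    using sbs_symmetric[OF z(1)] sbs_norm_symmetric[OF z(1)] by (auto simp: lorentz_p1_def l_def)
qed

end

section \<open>Mixed norms of multilinear forms\<close>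

lemma sum_PiE_insert:
  assumes "j \<notin> J"
  shows "(\<Sum>f\<in>PiE (insert j J) B. F f) = (\<Sum>b\<in>B j. \<Sum>f\<in>PiE J B. F (f(j := b)))"
  unfolding PiE_insert_eq sum.reindex[OF inj_combinator[OF assms]] sum.cartesian_product
  by (simp add: case_prod_unfold)

section \<open>Khinchine's inequality for vector-valued sign sums\<close>

lemma sum_cmod_squared_add_diff:
  fixes u h :: "'i \<Rightarrow> complex"
  shows "(\<Sum>i\<in>V. (cmod (u i + h i))\<^sup>2) = (\<Sum>i\<in>V. (cmod (u i))\<^sup>2) + (\<Sum>i\<in>V. (cmod (h i))\<^sup>2) + 2 * (\<Sum>i\<in>V. Re (u i * cnj (h i)))"
    and "(\<Sum>i\<in>V. (cmod (u i - h i))\<^sup>2) = (\<Sum>i\<in>V. (cmod (u i))\<^sup>2) + (\<Sum>i\<in>V. (cmod (h i))\<^sup>2) - 2 * (\<Sum>i\<in>V. Re (u i * cnj (h i)))"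
proof -
  have "(cmod (u i + h i))\<^sup>2 = (cmod (u i))\<^sup>2 + (cmod (h i))\<^sup>2 + 2 * Re (u i * cnj (h i))"
    "(cmod (u i - h i))\<^sup>2 = (cmod (u i))\<^sup>2 + (cmod (h i))\<^sup>2 - 2 * Re (u i * cnj (h i))" for i
    unfolding cmod_power2 by (simp_all add: power2_eq_square algebra_simps)
  then show "(\<Sum>i\<in>V. (cmod (u i + h i))\<^sup>2) = (\<Sum>i\<in>V. (cmod (u i))\<^sup>2) + (\<Sum>i\<in>V. (cmod (h i))\<^sup>2) + 2 * (\<Sum>i\<in>V. Re (u i * cnj (h i)))"
    "(\<Sum>i\<in>V. (cmod (u i - h i))\<^sup>2) = (\<Sum>i\<in>V. (cmod (u i))\<^sup>2) + (\<Sum>i\<in>V. (cmod (h i))\<^sup>2) - 2 * (\<Sum>i\<in>V. Re (u i * cnj (h i)))"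
    by (simp_all only: sum.distrib sum_subtractf sum_distrib_left)
qed

lemma Re_inner_sum_le:
  fixes u h :: "'i \<Rightarrow> complex"
  shows "(\<Sum>i\<in>V. Re (u i * cnj (h i)))\<^sup>2 \<le> (\<Sum>i\<in>V. (cmod (u i))\<^sup>2) * (\<Sum>i\<in>V. (cmod (h i))\<^sup>2)"
proof -
  have "\<bar>\<Sum>i\<in>V. Re (u i * cnj (h i))\<bar> \<le> (\<Sum>i\<in>V. \<bar>cmod (u i)\<bar> * \<bar>cmod (h i)\<bar>)"
    by (rule order_trans[OF sum_abs sum_mono]) (metis abs_Re_le_cmod abs_norm_cancel complex_mod_cnj norm_mult)
  also have "\<dots> \<le> L2_set (\<lambda>i. cmod (u i)) V * L2_set (\<lambda>i. cmod (h i)) V"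
    by (rule L2_set_mult_ineq)
  finally have "(\<Sum>i\<in>V. Re (u i * cnj (h i)))\<^sup>2 \<le> (L2_set (\<lambda>i. cmod (u i)) V * L2_set (\<lambda>i. cmod (h i)) V)\<^sup>2"
    by (rule abs_le_square_iff[THEN iffD1, OF order_trans]) simp
  then show ?thesis by (simp add: L2_set_def power_mult_distrib sum_nonneg)
qed

abbreviation signs :: "'j set \<Rightarrow> ('j \<Rightarrow> complex) set" where
  "signs J \<equiv> PiE J (\<lambda>_. {- 1, 1})"

lemma sum_signs_insert:
  assumes "j \<notin> J" "finite J"
  shows "(\<Sum>\<epsilon>\<in>signs (insert j J). F (\<lambda>i. \<Sum>l\<in>insert j J. \<epsilon> l * h l i))
    = (\<Sum>\<epsilon>\<in>signs J. F (\<lambda>i. (\<Sum>l\<in>J. \<epsilon> l * h l i) - h j i) + F (\<lambda>i. (\<Sum>l\<in>J. \<epsilon> l * h l i) + h j i) :: real)"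
proof -
  have "(\<Sum>l\<in>insert j J. (\<epsilon>(j := b)) l * h l i) = (\<Sum>l\<in>J. \<epsilon> l * h l i) + b * h j i" for \<epsilon> b i
  proof -
    have "(\<Sum>l\<in>J. (\<epsilon>(j := b)) l * h l i) = (\<Sum>l\<in>J. \<epsilon> l * h l i)"
      using assms(1) by (intro sum.cong) auto
    then show ?thesis using assms by simp
  qed
  then show ?thesis by (simp add: sum_PiE_insert[OF assms(1)] sum.distrib)
qed

text \<open>The cross terms of the two signs of a new vector cancel.\<close>

lemma khinchine_second_moment:
  fixes h :: "'j \<Rightarrow> 'i \<Rightarrow> complex"
  assumes "finite J"
  shows "(\<Sum>\<epsilon>\<in>signs J. \<Sum>i\<in>V. (cmod (\<Sum>j\<in>J. \<epsilon> j * h j i))\<^sup>2)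
    = 2 ^ card J * (\<Sum>j\<in>J. \<Sum>i\<in>V. (cmod (h j i))\<^sup>2)"
  using assms
proof (induction J)
  case (insert j J)
  then show ?case
    unfolding sum_signs_insert[OF insert(2,1), where F = "\<lambda>u. \<Sum>i\<in>V. (cmod (u i))\<^sup>2"] sum_cmod_squared_add_diff
    by (simp add: sum.distrib card_PiE algebra_simps flip: sum_distrib_left)
qed simp

text \<open>The two signs of a new vector contribute \<open>2 (q + r)^2 + 8 c^2\<close>, and
  Cauchy-Schwarz for \<open>c\<close> raises the mixed coefficient to 12. The constant 3 closes the
  induction, since \<open>6 T^2 + 12 r T + 6 r^2 = 6 (r + T)^2\<close>.\<close>

lemma khinchine_fourth_moment:
  fixes h :: "'j \<Rightarrow> 'i \<Rightarrow> complex"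
  assumes "finite J"
  shows "(\<Sum>\<epsilon>\<in>signs J. (\<Sum>i\<in>V. (cmod (\<Sum>j\<in>J. \<epsilon> j * h j i))\<^sup>2)\<^sup>2)
    \<le> 3 * 2 ^ card J * (\<Sum>j\<in>J. \<Sum>i\<in>V. (cmod (h j i))\<^sup>2)\<^sup>2"
  using assms
proof (induction J)
  case (insert j J)
  define q where "q \<epsilon> = (\<Sum>i\<in>V. (cmod (\<Sum>j\<in>J. \<epsilon> j * h j i))\<^sup>2)" for \<epsilon>
  define c where "c \<epsilon> = (\<Sum>i\<in>V. Re ((\<Sum>j\<in>J. \<epsilon> j * h j i) * cnj (h j i)))" for \<epsilon>
  define r where "r = (\<Sum>i\<in>V. (cmod (h j i))\<^sup>2)"
  define T where "T = (\<Sum>j\<in>J. \<Sum>i\<in>V. (cmod (h j i))\<^sup>2)"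
  have "r \<ge> 0" by (simp add: r_def sum_nonneg)
  have q1: "(\<Sum>\<epsilon>\<in>signs J. q \<epsilon>) = 2 ^ card J * T"
    unfolding q_def T_def by (rule khinchine_second_moment[OF insert(1)])
  have q2: "(\<Sum>\<epsilon>\<in>signs J. (q \<epsilon>)\<^sup>2) \<le> 3 * 2 ^ card J * T\<^sup>2"
    unfolding q_def T_def by (rule insert.IH)
  have c: "(c \<epsilon>)\<^sup>2 \<le> q \<epsilon> * r" for \<epsilon> unfolding c_def q_def r_def by (rule Re_inner_sum_le)
  have "(\<Sum>\<epsilon>\<in>signs (insert j J). (\<Sum>i\<in>V. (cmod (\<Sum>j\<in>insert j J. \<epsilon> j * h j i))\<^sup>2)\<^sup>2)
      = (\<Sum>\<epsilon>\<in>signs J. (q \<epsilon> + r - 2 * c \<epsilon>)\<^sup>2 + (q \<epsilon> + r + 2 * c \<epsilon>)\<^sup>2)"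
    unfolding sum_signs_insert[OF insert(2,1), where F = "\<lambda>u. (\<Sum>i\<in>V. (cmod (u i))\<^sup>2)\<^sup>2"] sum_cmod_squared_add_diff
      q_def r_def c_def ..
  also have "\<dots> \<le> (\<Sum>\<epsilon>\<in>signs J. 2 * (q \<epsilon>)\<^sup>2 + 12 * r * q \<epsilon> + 2 * r\<^sup>2)"
  proof (rule sum_mono)
    fix \<epsilon>
    show "(q \<epsilon> + r - 2 * c \<epsilon>)\<^sup>2 + (q \<epsilon> + r + 2 * c \<epsilon>)\<^sup>2 \<le> 2 * (q \<epsilon>)\<^sup>2 + 12 * r * q \<epsilon> + 2 * r\<^sup>2"
      using c[of \<epsilon>] by (simp add: power2_eq_square algebra_simps)
  qed
  also have "\<dots> = 2 * (\<Sum>\<epsilon>\<in>signs J. (q \<epsilon>)\<^sup>2) + 12 * r * (2 ^ card J * T) + 2 * r\<^sup>2 * 2 ^ card J"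
    using insert(1) by (simp add: sum.distrib card_PiE flip: sum_distrib_left q1)
  also have "\<dots> \<le> 2 * (3 * 2 ^ card J * T\<^sup>2) + 12 * r * (2 ^ card J * T) + 6 * r\<^sup>2 * 2 ^ card J"
    using q2 \<open>r \<ge> 0\<close> by (intro add_mono mult_left_mono mult_right_mono) auto
  also have "\<dots> = 3 * 2 ^ card (insert j J) * (r + T)\<^sup>2"
    using insert by (simp add: power2_eq_square algebra_simps)
  finally show ?case using insert by (simp add: r_def T_def)
qed simp

text \<open>The constant comes from testing the fourth moment bound against the pointwise
  inequality \<open>16 \<sigma>\<^sup>3 s \<ge> 8 \<sigma>\<^sup>2 s\<^sup>2 - s\<^sup>4\<close>.\<close>

lemma khinchine:
  fixes h :: "'j \<Rightarrow> 'i \<Rightarrow> complex"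
  assumes "finite J"
  shows "2 ^ card J * sqrt (\<Sum>j\<in>J. \<Sum>i\<in>V. (cmod (h j i))\<^sup>2)
    \<le> 4 * (\<Sum>\<epsilon>\<in>signs J. sqrt (\<Sum>i\<in>V. (cmod (\<Sum>j\<in>J. \<epsilon> j * h j i))\<^sup>2))"
proof -
  define q where "q \<epsilon> = (\<Sum>i\<in>V. (cmod (\<Sum>j\<in>J. \<epsilon> j * h j i))\<^sup>2)" for \<epsilon>
  define T where "T = (\<Sum>j\<in>J. \<Sum>i\<in>V. (cmod (h j i))\<^sup>2)"
  define \<sigma> where "\<sigma> = sqrt T"
  define N :: real where "N = 2 ^ card J"
  have T: "T = \<sigma>\<^sup>2" "0 \<le> \<sigma>" by (simp_all add: T_def \<sigma>_def sum_nonneg)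
  have q: "0 \<le> q \<epsilon>" for \<epsilon> by (simp add: q_def sum_nonneg)
  have pw: "8 * \<sigma>\<^sup>2 * q \<epsilon> - (q \<epsilon>)\<^sup>2 \<le> 16 * \<sigma> ^ 3 * sqrt (q \<epsilon>)" for \<epsilon>
  proof -
    define s where "s = sqrt (q \<epsilon>)"
    have s: "0 \<le> s" "q \<epsilon> = s\<^sup>2" using q by (auto simp: s_def)
    have "0 \<le> s * ((s - 2 * \<sigma>)\<^sup>2 * (s + 4 * \<sigma>) + 4 * \<sigma>\<^sup>2 * s)" using s T by simp
    also have "\<dots> = 16 * \<sigma> ^ 3 * s - (8 * \<sigma>\<^sup>2 * s\<^sup>2 - (s\<^sup>2)\<^sup>2)"
      by (simp add: power2_eq_square power3_eq_cube algebra_simps)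
    finally show ?thesis unfolding s(2)[symmetric] by (simp add: s_def)
  qed
  have "8 * \<sigma>\<^sup>2 * (N * \<sigma>\<^sup>2) - 3 * N * (\<sigma>\<^sup>2)\<^sup>2
      \<le> 8 * \<sigma>\<^sup>2 * (\<Sum>\<epsilon>\<in>signs J. q \<epsilon>) - (\<Sum>\<epsilon>\<in>signs J. (q \<epsilon>)\<^sup>2)"
    using khinchine_second_moment[OF assms, where V = V and h = h]
      khinchine_fourth_moment[OF assms, where V = V and h = h]
    unfolding q_def N_def T(1)[symmetric] T_def by simp
  also have "\<dots> = (\<Sum>\<epsilon>\<in>signs J. 8 * \<sigma>\<^sup>2 * q \<epsilon> - (q \<epsilon>)\<^sup>2)"
    by (simp add: sum_subtractf sum_distrib_left)
  also have "\<dots> \<le> (\<Sum>\<epsilon>\<in>signs J. 16 * \<sigma> ^ 3 * sqrt (q \<epsilon>))" by (intro sum_mono pw)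
  also have "\<dots> = \<sigma> ^ 3 * (16 * (\<Sum>\<epsilon>\<in>signs J. sqrt (q \<epsilon>)))" by (simp add: sum_distrib_left mult_ac)
  finally have "\<sigma> ^ 3 * (5 * N * \<sigma>) \<le> \<sigma> ^ 3 * (16 * (\<Sum>\<epsilon>\<in>signs J. sqrt (q \<epsilon>)))"
    by (simp add: power2_eq_square power3_eq_cube algebra_simps)
  moreover have "0 \<le> (\<Sum>\<epsilon>\<in>signs J. sqrt (q \<epsilon>))" using q by (simp add: sum_nonneg)
  moreover have "0 \<le> N * \<sigma>" using T by (simp add: N_def)
  \<comment> \<open>The moments leave \<open>8 - 3 = 5\<close> against 16, and the ratio 16/5 is
    rounded up to 4.\<close>
  ultimately have "N * \<sigma> \<le> 4 * (\<Sum>\<epsilon>\<in>signs J. sqrt (q \<epsilon>))"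
  proof (cases "\<sigma> = 0")
    case False
    then have "5 * N * \<sigma> \<le> 16 * (\<Sum>\<epsilon>\<in>signs J. sqrt (q \<epsilon>))"
      using T(2) \<open>\<sigma> ^ 3 * _ \<le> _\<close> by (subst (asm) mult_le_cancel_left_pos) auto
    then show ?thesis using \<open>0 \<le> N * \<sigma>\<close> by linarith
  qed simp
  then show ?thesis by (simp add: N_def \<sigma>_def q_def T_def)
qed

text \<open>One variable at a time is replaced by signs, which are admissible arguments. The
  vector-valued inequality keeps the square sum over the remaining variables under the root, and
  each variable costs a factor 4.\<close>

lemma multilinear_khinchine:
  fixes a :: "('k \<Rightarrow> 'j) \<Rightarrow> 'v \<Rightarrow> complex" and B :: real
  assumes "finite T" "finite I"
    and "\<And>x. (\<And>k i. cmod (x k i) \<le> 1) \<Longrightarrow>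
      (\<Sum>v\<in>V. cmod (\<Sum>f\<in>PiE T (\<lambda>_. I). a f v * (\<Prod>k\<in>T. x k (f k)))) \<le> B"
  shows "(\<Sum>v\<in>V. sqrt (\<Sum>f\<in>PiE T (\<lambda>_. I). (cmod (a f v))\<^sup>2)) \<le> 4 ^ card T * B"
  using assms(1,3)
proof (induction T arbitrary: a)
  case empty
  from empty[of "\<lambda>_ _. 0"] show ?case by simp
next
  case (insert t T)
  let ?P = "PiE T (\<lambda>_. I)"
  let ?a = "\<lambda>\<epsilon> f v. \<Sum>j\<in>I. \<epsilon> j * a (f(t := j)) v"
  have IH: "(\<Sum>v\<in>V. sqrt (\<Sum>f\<in>?P. (cmod (?a \<epsilon> f v))\<^sup>2)) \<le> 4 ^ card T * B"
    if "\<epsilon> \<in> signs I" for \<epsilon>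
  proof (rule insert.IH)
    fix x :: "'k \<Rightarrow> 'j \<Rightarrow> complex" assume x: "\<And>k i. cmod (x k i) \<le> 1"
    \<comment> \<open>A sign function is \<open>undefined\<close> outside \<open>I\<close>;
      extension by 0 keeps the bound at every index.\<close>
    define y where "y = x(t := \<lambda>j. if j \<in> I then \<epsilon> j else 0)"
    have y: "cmod (y k i) \<le> 1" for k i
      using x that by (auto simp: y_def PiE_def Pi_def)
    have "(\<Sum>f\<in>?P. ?a \<epsilon> f v * (\<Prod>k\<in>T. x k (f k)))
        = (\<Sum>f\<in>PiE (insert t T) (\<lambda>_. I). a f v * (\<Prod>k\<in>insert t T. y k (f k)))" for v
    proof -
      have "(\<Prod>k\<in>T. y k ((f(t := j)) k)) = (\<Prod>k\<in>T. x k (f k))" for f j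
        using insert(2) by (intro prod.cong) (auto simp: y_def)
      moreover have "y t j = \<epsilon> j" if "j \<in> I" for j using that by (simp add: y_def)
      ultimately show ?thesis
        using insert(1,2) by (simp add: sum_PiE_insert sum_distrib_left sum_distrib_right mult_ac sum.swap[of _ ?P I])
    qed
    then show "(\<Sum>v\<in>V. cmod (\<Sum>f\<in>?P. ?a \<epsilon> f v * (\<Prod>k\<in>T. x k (f k)))) \<le> B"
      using insert.prems[OF y] by simp
  qed
  have "2 ^ card I * (\<Sum>v\<in>V. sqrt (\<Sum>f\<in>PiE (insert t T) (\<lambda>_. I). (cmod (a f v))\<^sup>2))
      = (\<Sum>v\<in>V. 2 ^ card I * sqrt (\<Sum>j\<in>I. \<Sum>f\<in>?P. (cmod (a (f(t := j)) v))\<^sup>2))"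
    using insert(2) by (simp add: sum_PiE_insert sum_distrib_left)
  also have "\<dots> \<le> (\<Sum>v\<in>V. 4 * (\<Sum>\<epsilon>\<in>signs I. sqrt (\<Sum>f\<in>?P. (cmod (?a \<epsilon> f v))\<^sup>2)))"
    by (intro sum_mono khinchine assms(2))
  also have "\<dots> = 4 * (\<Sum>\<epsilon>\<in>signs I. \<Sum>v\<in>V. sqrt (\<Sum>f\<in>?P. (cmod (?a \<epsilon> f v))\<^sup>2))"
    by (simp add: sum_distrib_left sum.swap[of _ V])
  also have "\<dots> \<le> 4 * (\<Sum>\<epsilon>\<in>signs I. 4 ^ card T * B)"
    by (intro mult_left_mono sum_mono IH) auto
  also have "\<dots> = 2 ^ card I * (4 ^ card (insert t T) * B)"
    using insert(1,2) assms(2) by (simp add: card_PiE)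
  finally show ?case by simp
qed

lemma finite_Mset [simp]: "finite (Mset m n)"
  by (simp add: Mset_def finite_PiE)

lemma finite_Jset [simp]: "finite (Jset m n)"
  by (simp add: Jset_def)

text \<open>A real supremum is an upper bound only when the set is bounded above; the
  \<open>l1\<close> sum of the coefficients ensures this.\<close>

lemma cmod_le_mult_norm:
  assumes "\<And>k i. k < m \<Longrightarrow> i \<in> {1..n} \<Longrightarrow> cmod (x k i) \<le> 1"
  shows "cmod (\<Sum>i\<in>Mset m n. a i * (\<Prod>k<m. x k (i k))) \<le> mult_norm m n a"
  unfolding mult_norm_def
proof (rule cSUP_upper)
  show "bdd_above ((\<lambda>x. cmod (\<Sum>i\<in>Mset m n. a i * (\<Prod>k<m. x k (i k)))) ` {x. \<forall>k<m. \<forall>i\<in>{1..n}. cmod (x k i) \<le> 1})"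
  proof (rule bdd_aboveI2)
    fix x :: "nat \<Rightarrow> nat \<Rightarrow> complex" assume x: "x \<in> {x. \<forall>k<m. \<forall>i\<in>{1..n}. cmod (x k i) \<le> 1}"
    show "cmod (\<Sum>i\<in>Mset m n. a i * (\<Prod>k<m. x k (i k))) \<le> (\<Sum>i\<in>Mset m n. cmod (a i))"
    proof (rule order_trans[OF norm_sum sum_mono])
      fix i assume "i \<in> Mset m n"
      then have "cmod (\<Prod>k<m. x k (i k)) \<le> 1"
        using x unfolding prod_norm[symmetric] by (intro prod_le_1) (auto simp: Mset_def PiE_def Pi_def)
      then show "cmod (a i * (\<Prod>k<m. x k (i k))) \<le> cmod (a i)"
        by (simp add: norm_mult mult_left_le)
    qed
  qed
qed (use assms in auto)

lemma mult_norm_nonneg: "0 \<le> mult_norm m n a"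
  using cmod_le_mult_norm[of m n "\<lambda>_ _. 0" a] norm_ge_zero order_trans by (metis norm_zero zero_le_one)

lemma Mset_split:
  assumes "k < m"
  shows "(\<Sum>i\<in>Mset m n. F i) = (\<Sum>v\<in>{1..n}. \<Sum>f\<in>PiE ({..<m} - {k}) (\<lambda>_. {1..n}). F (f(k := v)))"
proof -
  have "Mset m n = PiE (insert k ({..<m} - {k})) (\<lambda>_. {1..n})"
    using assms by (simp add: Mset_def insert_absorb)
  then show ?thesis using sum_PiE_insert[where j = k and J = "{..<m} - {k}" and F = F and B = "\<lambda>_. {1..n}"] by (simp only: Diff_iff insertI1 simp_thms)
qed

lemma sum_slice:
  assumes "k < m" "v \<in> {1..n}"
  shows "(\<Sum>i | i \<in> Mset m n \<and> i k = v. F i) = (\<Sum>f\<in>PiE ({..<m} - {k}) (\<lambda>_. {1..n}). F (f(k := v)))"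
  using assms unfolding Mset_def
  by (intro sum.reindex_bij_witness[where i = "\<lambda>f. f(k := v)" and j = "\<lambda>i. i(k := undefined)"])
    (auto simp: PiE_def Pi_def extensional_def fun_eq_iff)

lemma cnj_sgn_mult: "cnj (sgn z) * z = complex_of_real (cmod z)"
proof -
  have "cnj (sgn z) * z = complex_of_real (inverse (cmod z)) * (z * cnj z)"
    by (simp add: sgn_div_norm scaleR_conv_of_real)
  also have "\<dots> = complex_of_real (inverse (cmod z) * (cmod z)\<^sup>2)"
    by (simp only: complex_norm_square[symmetric] of_real_mult)
  also have "inverse (cmod z) * (cmod z)\<^sup>2 = cmod z"
    by (cases "z = 0") (simp_all add: power2_eq_square)
  finally show ?thesis .
qed

text \<open>With the other arguments fixed, suitable phases in variable \<open>k\<close> turn the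
  sum of moduli over \<open>v\<close> into one value of the form. This is the hypothesis of
  \<open>multilinear_khinchine\<close> for the other \<open>m - 1\<close> variables.\<close>

lemma mixed_norm_le_mult_norm:
  assumes "k < m"
  shows "(\<Sum>v\<in>{1..n}. sqrt (\<Sum>i | i \<in> Mset m n \<and> i k = v. (cmod (a i))\<^sup>2)) \<le> 4 ^ (m - 1) * mult_norm m n a"
proof -
  let ?T = "{..<m} - {k}" and ?I = "{1..n}"
  have "(\<Sum>v\<in>{1..n}. sqrt (\<Sum>f\<in>PiE ?T (\<lambda>_. ?I). (cmod (a (f(k := v))))\<^sup>2)) \<le> 4 ^ card ?T * mult_norm m n a"
  proof (rule multilinear_khinchine)
    fix x :: "nat \<Rightarrow> nat \<Rightarrow> complex" assume x: "\<And>k i. cmod (x k i) \<le> 1"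
    define Z where "Z v = (\<Sum>f\<in>PiE ?T (\<lambda>_. ?I). a (f(k := v)) * (\<Prod>l\<in>?T. x l (f l)))" for v
    define y where "y = x(k := \<lambda>v. cnj (sgn (Z v)))"
    have y: "cmod (y l i) \<le> 1" for l i using x by (simp add: y_def norm_sgn)
    have "y k v * Z v = complex_of_real (cmod (Z v))" for v
      by (simp add: y_def cnj_sgn_mult)
    then have "complex_of_real (\<Sum>v\<in>?I. cmod (Z v)) = (\<Sum>v\<in>?I. y k v * Z v)" by simp
    also have "\<dots> = (\<Sum>i\<in>Mset m n. a i * (\<Prod>l<m. y l (i l)))"
    proof -
      have "(\<Prod>l<m. y l ((f(k := v)) l)) = y k v * (\<Prod>l\<in>?T. x l (f l))" for f v
      proof -
        have "(\<Prod>l\<in>?T. y l ((f(k := v)) l)) = (\<Prod>l\<in>?T. x l (f l))"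
          by (intro prod.cong) (auto simp: y_def)
        then show ?thesis using assms by (simp add: prod.remove[of "{..<m}" k])
      qed
      then show ?thesis
        unfolding Mset_split[OF assms] Z_def by (simp add: sum_distrib_left mult_ac)
    qed
    finally have "cmod (complex_of_real (\<Sum>v\<in>?I. cmod (Z v))) = cmod (\<Sum>i\<in>Mset m n. a i * (\<Prod>l<m. y l (i l)))"
      by simp
    also have "\<dots> \<le> mult_norm m n a" by (rule cmod_le_mult_norm) (rule y)
    finally have "\<bar>\<Sum>v\<in>?I. cmod (Z v)\<bar> \<le> mult_norm m n a" by (simp only: norm_of_real)
    then show "(\<Sum>v\<in>?I. cmod (\<Sum>f\<in>PiE ?T (\<lambda>_. ?I). a (f(k := v)) * (\<Prod>l\<in>?T. x l (f l)))) \<le> mult_norm m n a"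
      by (simp add: Z_def)
  qed auto
  then show ?thesis using assms by (simp add: sum_slice)
qed

section \<open>From mixed norms to the Lorentz norm\<close>

lemma sum_mult_le_sqrt:
  fixes f g :: "'i \<Rightarrow> real"
  shows "(\<Sum>i\<in>G. \<bar>f i\<bar> * \<bar>g i\<bar>) \<le> sqrt (\<Sum>i\<in>G. (f i)\<^sup>2) * sqrt (\<Sum>i\<in>G. (g i)\<^sup>2)"
  using L2_set_mult_ineq[of f g G] by (simp add: L2_set_def)

text \<open>Distinct ranks below \<open>r\<close> contribute no more than all ranks below
  \<open>r\<close>, and each weight is at most \<open>m\<close> times an increment of the
  \<open>1/m\<close>-th power, so the sum telescopes.\<close>

lemma sum_powr_le:
  assumes "1 \<le> m" "finite A" "inj_on \<rho> A" "\<And>i. i \<in> A \<Longrightarrow> \<rho> i < r"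
  shows "(\<Sum>i\<in>A. real (Suc (\<rho> i)) powr (1 / real m - 1)) \<le> real m * real r powr (1 / real m)"
proof -
  have "(\<Sum>i\<in>A. real (Suc (\<rho> i)) powr (1 / real m - 1)) = (\<Sum>k\<in>\<rho> ` A. real (Suc k) powr (1 / real m - 1))"
    by (simp add: sum.reindex[OF assms(3)])
  also have "\<dots> \<le> (\<Sum>k<r. real (Suc k) powr (1 / real m - 1))"
    using assms(4) by (intro sum_mono2) auto
  also have "\<dots> \<le> (\<Sum>k<r. real m * (real (Suc k) powr (1 / real m) - real k powr (1 / real m)))"
  proof (rule sum_mono)
    fix k
    have "1 / real m * real (Suc k) powr (1 / real m - 1) \<le> real (Suc k) powr (1 / real m) - real k powr (1 / real m)"
      using assms(1) by (intro powr_increment_ge) auto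
    then show "real (Suc k) powr (1 / real m - 1) \<le> real m * (real (Suc k) powr (1 / real m) - real k powr (1 / real m))"
      using assms(1) by (simp add: field_simps)
  qed
  also have "\<dots> = real m * real r powr (1 / real m)"
    by (simp only: sum_distrib_left[symmetric] sum_powr_increment)
  finally show ?thesis .
qed

text \<open>Charge every point, in order of its rank, to a coordinate hyperplane through it which has
  so far received little weight. By counting, the points all of whose hyperplanes are already heavy
  are so sparse that re-ranking them gains a constant factor, and the argument can be iterated.\<close>

lemma weighted_sum_le_mixed_norm:
  fixes a :: "(nat \<Rightarrow> nat) \<Rightarrow> complex" and D :: real
  assumes m: "1 \<le> m"
    and D: "\<And>k. k < m \<Longrightarrow> (\<Sum>v\<in>{1..n}. sqrt (\<Sum>i | i \<in> Mset m n \<and> i k = v. (cmod (a i))\<^sup>2)) \<le> D"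
    and A: "A \<subseteq> Mset m n" "inj_on \<rho> A"
  shows "(\<Sum>i\<in>A. cmod (a i) * real (Suc (\<rho> i)) powr ((real m + 1) / (2 * real m) - 1))
    \<le> 4 * (real m * sqrt (2 * real m + 1)) * D"
  using A
proof (induction "card A" arbitrary: A \<rho> rule: less_induct)
  case less
  define \<beta> :: "nat \<Rightarrow> real" where "\<beta> r = real (Suc r) powr ((real m + 1) / (2 * real m) - 1)" for r
  define \<gamma> :: "nat \<Rightarrow> real" where "\<gamma> r = real (Suc r) powr (1 / real m - 1)" for r
  \<comment> \<open>The load placed by entries ranked before \<open>r\<close> on the hyperplane of
    direction \<open>k\<close> at height \<open>v\<close>. All entries of \<open>A\<close> count,
    charged there or not, so the load does not depend on the later choice of
    \<open>\<kappa>\<close>.\<close>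
  define W where "W k r v = (\<Sum>j | j \<in> A \<and> j k = v \<and> \<rho> j < r. \<gamma> (\<rho> j))" for k r v
  \<comment> \<open>The threshold is twice the constant \<open>m\<close> of
    \<open>sum_powr_le\<close>; this 2 becomes the sparsity factor \<open>2 ^ m\<close>.\<close>
  define bad where "bad = {i \<in> A. \<forall>k<m. 2 * real m \<le> W k (\<rho> i) (i k)}"
  have finA: "finite A" using less.prems(1) by (rule finite_subset) simp
  have inA: "i k \<in> {1..n}" if "i \<in> A" "k < m" for i k
    using less.prems(1) that by (auto simp: Mset_def PiE_def Pi_def)
  have \<beta>2: "(\<beta> r)\<^sup>2 = \<gamma> r" for r
  proof -
    have "(\<beta> r)\<^sup>2 = real (Suc r) powr (2 * ((real m + 1) / (2 * real m) - 1))"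
      by (simp only: \<beta>_def power2_eq_square powr_add[symmetric] mult_2)
    also have "2 * ((real m + 1) / (2 * real m) - 1) = 1 / real m - 1"
      using m by (simp add: field_simps)
    finally show ?thesis by (simp add: \<gamma>_def)
  qed
  have \<beta>0: "0 \<le> \<beta> r" for r by (simp add: \<beta>_def)
  have \<gamma>: "0 \<le> \<gamma> r" "\<gamma> r \<le> 1" for r
  proof -
    show "0 \<le> \<gamma> r" by (simp add: \<gamma>_def)
    have "real (Suc r) powr (1 / real m - 1) \<le> real (Suc r) powr 0"
      using m by (intro powr_mono) (auto simp: field_simps)
    then show "\<gamma> r \<le> 1" by (simp add: \<gamma>_def)
  qed
  have W_mono: "W k r v \<le> W k r' v" if "r \<le> r'" for k r r' v
    unfolding W_def using that finA \<gamma> by (intro sum_mono2) auto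
  have D0: "0 \<le> D"
    using m by (intro order_trans[OF sum_nonneg D[of 0]]) (simp_all add: sum_nonneg)

  have "\<forall>i\<in>A - bad. \<exists>k<m. W k (\<rho> i) (i k) < 2 * real m"
    unfolding bad_def by (simp add: not_le)
  then obtain \<kappa> where \<kappa>: "\<And>i. i \<in> A - bad \<Longrightarrow> \<kappa> i < m \<and> W (\<kappa> i) (\<rho> i) (i (\<kappa> i)) < 2 * real m"
    using bchoice[of "A - bad" "\<lambda>i k. k < m \<and> W k (\<rho> i) (i k) < 2 * real m"] by blast
  define G where "G k v = {i \<in> A - bad. \<kappa> i = k \<and> i k = v}" for k v
  have finG: "finite (G k v)" for k v using finA by (auto simp: G_def)
  \<comment> \<open>The last point \<open>l\<close> charged to a hyperplane found a load below
    \<open>2 m\<close>. All others charged there precede \<open>l\<close> and are part of that load,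
    and \<open>l\<close> itself adds at most 1.\<close>
  have load: "(\<Sum>i\<in>G k v. \<gamma> (\<rho> i)) \<le> 2 * real m + 1" for k v
  proof (cases "G k v = {}")
    case False
    obtain l where l: "l \<in> G k v" "\<And>i. i \<in> G k v \<Longrightarrow> \<rho> i \<le> \<rho> l"
      using obtains_MAX[OF finG False, of \<rho>] finG by (metis Max_ge finite_imageI imageI)
    have "(\<Sum>i\<in>G k v. \<gamma> (\<rho> i)) = \<gamma> (\<rho> l) + (\<Sum>i\<in>G k v - {l}. \<gamma> (\<rho> i))"
      by (rule sum.remove[OF finG l(1)])
    also have "(\<Sum>i\<in>G k v - {l}. \<gamma> (\<rho> i)) \<le> W k (\<rho> l) v"
      unfolding W_def
    proof (rule sum_mono2)
      show "G k v - {l} \<subseteq> {j. j \<in> A \<and> j k = v \<and> \<rho> j < \<rho> l}"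
      proof
        fix i assume i: "i \<in> G k v - {l}"
        then have "\<rho> i \<noteq> \<rho> l" using less.prems(2) l(1) by (auto simp: G_def inj_on_def)
        then show "i \<in> {j. j \<in> A \<and> j k = v \<and> \<rho> j < \<rho> l}"
          using l(2)[of i] i by (auto simp: G_def)
      qed
    qed (use finA \<gamma> in auto)
    also have "W k (\<rho> l) v \<le> 2 * real m"
      using \<kappa>[of l] l(1) by (auto simp: G_def)
    finally show ?thesis using \<gamma>(2)[of "\<rho> l"] by linarith
  qed simp
  have good: "(\<Sum>i\<in>A - bad. cmod (a i) * \<beta> (\<rho> i)) \<le> real m * sqrt (2 * real m + 1) * D"
  proof -
    have "A - bad = (\<Union>k<m. \<Union>v\<in>{1..n}. G k v)"
      using \<kappa> inA by (auto simp: G_def)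
    then have "(\<Sum>i\<in>A - bad. cmod (a i) * \<beta> (\<rho> i)) = (\<Sum>i\<in>(\<Union>k<m. \<Union>v\<in>{1..n}. G k v). cmod (a i) * \<beta> (\<rho> i))"
      by simp
    also have "\<dots> = (\<Sum>k<m. \<Sum>i\<in>(\<Union>v\<in>{1..n}. G k v). cmod (a i) * \<beta> (\<rho> i))"
      using finG by (intro sum.UNION_disjoint) (auto simp: G_def)
    also have "\<dots> = (\<Sum>k<m. \<Sum>v\<in>{1..n}. \<Sum>i\<in>G k v. cmod (a i) * \<beta> (\<rho> i))"
      using finG by (intro sum.cong refl sum.UNION_disjoint) (auto simp: G_def)
    also have "\<dots> \<le> (\<Sum>k<m. \<Sum>v\<in>{1..n}. sqrt (\<Sum>i | i \<in> Mset m n \<and> i k = v. (cmod (a i))\<^sup>2) * sqrt (2 * real m + 1))"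
    proof (intro sum_mono)
      fix k v
      have "(\<Sum>i\<in>G k v. cmod (a i) * \<beta> (\<rho> i)) \<le> sqrt (\<Sum>i\<in>G k v. (cmod (a i))\<^sup>2) * sqrt (\<Sum>i\<in>G k v. (\<beta> (\<rho> i))\<^sup>2)"
        using sum_mult_le_sqrt[of "\<lambda>i. cmod (a i)" "\<lambda>i. \<beta> (\<rho> i)" "G k v"] \<beta>0 by simp
      also have "\<dots> \<le> sqrt (\<Sum>i | i \<in> Mset m n \<and> i k = v. (cmod (a i))\<^sup>2) * sqrt (2 * real m + 1)"
        using load[of k v] less.prems(1) unfolding \<beta>2
        by (intro mult_mono real_sqrt_le_mono sum_mono2) (auto simp: G_def sum_nonneg \<gamma>)
      finally show "(\<Sum>i\<in>G k v. cmod (a i) * \<beta> (\<rho> i))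
        \<le> sqrt (\<Sum>i | i \<in> Mset m n \<and> i k = v. (cmod (a i))\<^sup>2) * sqrt (2 * real m + 1)" .
    qed
    also have "\<dots> \<le> (\<Sum>k<m. D * sqrt (2 * real m + 1))"
      unfolding sum_distrib_right[symmetric] using D by (intro sum_mono mult_right_mono) auto
    finally show ?thesis by (simp add: mult_ac)
  qed

  define full where "full k r = {v. 2 * real m \<le> W k r v}" for k r
  have W0: "W k r v = 0" if "v \<notin> (\<lambda>i. i k) ` A" for k r v
    unfolding W_def using that by (intro sum.neutral) auto
  have fin_full: "finite (full k r)" for k r
  proof (rule finite_subset)
    show "full k r \<subseteq> (\<lambda>i. i k) ` A" using W0 m by (force simp: full_def)
  qed (use finA in auto)
  \<comment> \<open>Different heights in one direction collect disjoint sets of entries. Each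
    overloaded one uses up at least \<open>2 m\<close> of a total of at most
    \<open>m r^(1/m)\<close>.\<close>
  have card_full: "real (card (full k r)) \<le> real r powr (1 / real m) / 2" for k r
  proof -
    have "2 * real m * real (card (full k r)) \<le> (\<Sum>v\<in>full k r. W k r v)"
      using sum_mono[of "full k r" "\<lambda>_. 2 * real m" "W k r"] by (simp add: full_def mult.commute)
    also have "\<dots> = (\<Sum>j\<in>(\<Union>v\<in>full k r. {j. j \<in> A \<and> j k = v \<and> \<rho> j < r}). \<gamma> (\<rho> j))"
      unfolding W_def using fin_full finA by (intro sum.UNION_disjoint[symmetric]) auto
    also have "\<dots> \<le> real m * real r powr (1 / real m)"
      unfolding \<gamma>_def using m finA less.prems(2) fin_full
      by (intro sum_powr_le) (auto intro: inj_on_subset)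
    finally show ?thesis using m by (simp add: field_simps)
  qed
  define \<rho>' where "\<rho>' i = card {j \<in> bad. \<rho> j < \<rho> i}" for i
  have bad_sub: "bad \<subseteq> A" by (auto simp: bad_def)
  have fin_bad: "finite bad" using finA bad_sub finite_subset by blast
  \<comment> \<open>Loads grow with rank, so bad points ranked up to that of \<open>i\<close> have
    overloaded coordinates at the level \<open>\<rho> i\<close> in all directions. They lie in a
    product of \<open>m\<close> sets, each of size at most half the \<open>m\<close>-th root of
    \<open>\<rho> i\<close>.\<close>
  have sparse: "2 ^ m * real (Suc (\<rho>' i)) \<le> real (Suc (\<rho> i))" if i: "i \<in> bad" for i
  proof -
    have "insert i {j \<in> bad. \<rho> j < \<rho> i} \<subseteq> PiE {..<m} (\<lambda>k. full k (\<rho> i))"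
    proof
      fix j assume "j \<in> insert i {j \<in> bad. \<rho> j < \<rho> i}"
      then have j: "j \<in> bad" "\<rho> j \<le> \<rho> i" using i by auto
      then have "j \<in> extensional {..<m}"
        using less.prems(1) bad_sub by (auto simp: Mset_def PiE_def)
      moreover have "j k \<in> full k (\<rho> i)" if "k < m" for k
        using j that W_mono[OF j(2), of k "j k"] by (force simp: full_def bad_def)
      ultimately show "j \<in> PiE {..<m} (\<lambda>k. full k (\<rho> i))" by (simp add: PiE_def)
    qed
    then have "card (insert i {j \<in> bad. \<rho> j < \<rho> i}) \<le> card (PiE {..<m} (\<lambda>k. full k (\<rho> i)))"
      using fin_full by (intro card_mono finite_PiE) auto
    then have "Suc (\<rho>' i) \<le> (\<Prod>k<m. card (full k (\<rho> i)))"
      using fin_bad by (simp add: \<rho>'_def card_PiE)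
    then have "real (Suc (\<rho>' i)) \<le> (\<Prod>k<m. real (card (full k (\<rho> i))))"
      by (metis of_nat_le_iff of_nat_prod)
    also have "\<dots> \<le> (\<Prod>k<m. real (\<rho> i) powr (1 / real m) / 2)"
      by (intro prod_mono conjI card_full) auto
    also have "\<dots> = (real (\<rho> i) powr (1 / real m)) ^ m / 2 ^ m"
      by (simp add: power_divide)
    also have "(real (\<rho> i) powr (1 / real m)) ^ m = real (\<rho> i)"
      using m by (cases "\<rho> i = 0") (simp_all add: powr_power)
    finally show ?thesis by (simp add: field_simps)
  qed
  have inj': "inj_on \<rho>' bad"
  proof (rule inj_onI)
    have lt: "\<rho>' i < \<rho>' j" if "i \<in> bad" "\<rho> i < \<rho> j" for i j
      unfolding \<rho>'_def using that fin_bad by (intro psubset_card_mono) auto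
    fix i j assume ij: "i \<in> bad" "j \<in> bad" "\<rho>' i = \<rho>' j"
    then have "\<rho> i = \<rho> j" using lt[of i j] lt[of j i] by (metis less_irrefl nat_neq_iff)
    then show "i = j" using less.prems(2) ij bad_sub by (auto simp: inj_on_def)
  qed
  have badsum: "(\<Sum>i\<in>bad. cmod (a i) * \<beta> (\<rho> i)) \<le> 3/4 * (4 * (real m * sqrt (2 * real m + 1)) * D)"
  \<comment> \<open>For \<open>m = 1\<close> the weight exponent is 0 and re-ranking gains nothing,
    but there a hyperplane is a single point, which carries no load before its own rank.\<close>
  proof (cases "m = 1 \<or> A = {}")
    case True
    have "bad = {}"
    proof (rule ccontr)
      assume "bad \<noteq> {}"
      then obtain i where i: "i \<in> bad" by blast
      then have m1: "m = 1" using True bad_sub by auto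
      have empty: "{j. j \<in> A \<and> j 0 = i 0 \<and> \<rho> j < \<rho> i} = {}"
      proof (rule ccontr)
        assume "\<not> ?thesis"
        then obtain j where j: "j \<in> A" "j 0 = i 0" "\<rho> j < \<rho> i" by auto
        have "j = i"
        proof (rule PiE_ext)
          show "j \<in> PiE {..<m} (\<lambda>_. {1..n})" "i \<in> PiE {..<m} (\<lambda>_. {1..n})"
            using j(1) i bad_sub less.prems(1) unfolding Mset_def by blast+
          show "j k = i k" if "k \<in> {..<m}" for k using that j(2) m1 by simp
        qed
        then show False using j by simp
      qed
      have "W 0 (\<rho> i) (i 0) = 0" unfolding W_def empty by simp
      then show False using i m1 by (auto simp: bad_def)
    qed
    then show ?thesis using D0 by simp
  next
    case False
    then have m2: "2 \<le> m" and "A \<noteq> {}" using m by auto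
    obtain l where l: "l \<in> A" "\<And>i. i \<in> A \<Longrightarrow> \<rho> l \<le> \<rho> i"
      using obtains_MIN[OF finA \<open>A \<noteq> {}\<close>, of \<rho>] finA by (metis Min_le finite_imageI imageI)
    \<comment> \<open>Nothing precedes the entry of least rank, so it is not bad; the bad set is
      strictly smaller and the induction applies.\<close>
    have "l \<notin> bad"
    proof
      assume "l \<in> bad"
      moreover have "W 0 (\<rho> l) (l 0) = 0" unfolding W_def using l(2) by (intro sum.neutral) (force simp: not_less[symmetric])
      ultimately show False using m by (auto simp: bad_def)
    qed
    then have "card bad < card A" using bad_sub l(1) finA by (intro psubset_card_mono) auto
    then have IH: "(\<Sum>i\<in>bad. cmod (a i) * \<beta> (\<rho>' i)) \<le> 4 * (real m * sqrt (2 * real m + 1)) * D"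
      unfolding \<beta>_def using bad_sub less.prems(1) inj' by (intro less.hyps) auto
    \<comment> \<open>A rank larger by \<open>2 ^ m\<close> lowers the weight by
      \<open>2^((1-m)/2)\<close>, at most 3/4 for \<open>m >= 2\<close>. This is the origin of the 4
      in the statement: the good entries take a quarter of the bound and the bad ones at most three
      quarters.\<close>
    have gain: "\<beta> (\<rho> i) \<le> 3/4 * \<beta> (\<rho>' i)" if "i \<in> bad" for i
    proof -
      let ?e = "(real m + 1) / (2 * real m) - 1"
      have e: "?e \<le> 0" "real m * ?e \<le> - (1/2)" using m2 by (auto simp: field_simps)
      have "\<beta> (\<rho> i) \<le> (2 ^ m * real (Suc (\<rho>' i))) powr ?e"
        unfolding \<beta>_def using sparse[OF that] e by (intro powr_mono2') auto
      also have "\<dots> = 2 powr (real m * ?e) * \<beta> (\<rho>' i)"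
      proof -
        have "(2 ^ m :: real) powr ?e = 2 powr (real m * ?e)"
          by (metis powr_powr powr_realpow zero_less_numeral)
        then show ?thesis unfolding \<beta>_def by (subst powr_mult) simp_all
      qed
      also have "2 powr (real m * ?e) \<le> 2 powr (- (1/2))"
        using e(2) by (intro powr_mono) auto
      also have "(2::real) powr (- (1/2)) = 1 / sqrt 2"
        by (subst powr_minus_divide) (simp add: powr_half_sqrt)
      also have "\<dots> \<le> 3/4"
      proof -
        have "4/3 \<le> sqrt 2" by (rule real_le_rsqrt) (simp add: power2_eq_square)
        then show ?thesis by (simp add: field_simps)
      qed
      finally show ?thesis using \<beta>0 by (simp add: mult_right_mono)
    qed
    have "(\<Sum>i\<in>bad. cmod (a i) * \<beta> (\<rho> i)) \<le> (\<Sum>i\<in>bad. 3/4 * (cmod (a i) * \<beta> (\<rho>' i)))"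
    proof (rule sum_mono)
      fix i assume "i \<in> bad"
      then show "cmod (a i) * \<beta> (\<rho> i) \<le> 3/4 * (cmod (a i) * \<beta> (\<rho>' i))"
        using mult_left_mono[OF gain, of i "cmod (a i)"] by simp
    qed
    also have "\<dots> = 3/4 * (\<Sum>i\<in>bad. cmod (a i) * \<beta> (\<rho>' i))" by (simp add: sum_distrib_left)
    finally show ?thesis using IH by linarith
  qed
  have "(\<Sum>i\<in>A. cmod (a i) * \<beta> (\<rho> i)) = (\<Sum>i\<in>A - bad. cmod (a i) * \<beta> (\<rho> i)) + (\<Sum>i\<in>bad. cmod (a i) * \<beta> (\<rho> i))"
    by (rule sum.subset_diff[OF bad_sub finA])
  then show ?case using good badsum unfolding \<beta>_def by linarith
qed

section \<open>Polarization\<close>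

lemma cmod_le_pol_norm:
  assumes "\<And>i. i \<in> {1..n} \<Longrightarrow> cmod (z i) \<le> 1"
  shows "cmod (\<Sum>j\<in>Jset m n. c j * (\<Prod>k<m. z (j k))) \<le> pol_norm m n c"
  unfolding pol_norm_def
proof (rule cSUP_upper)
  show "bdd_above ((\<lambda>z. cmod (\<Sum>j\<in>Jset m n. c j * (\<Prod>k<m. z (j k)))) ` {z. \<forall>i\<in>{1..n}. cmod (z i) \<le> 1})"
  proof (rule bdd_aboveI2)
    fix z :: "nat \<Rightarrow> complex" assume z: "z \<in> {z. \<forall>i\<in>{1..n}. cmod (z i) \<le> 1}"
    show "cmod (\<Sum>j\<in>Jset m n. c j * (\<Prod>k<m. z (j k))) \<le> (\<Sum>j\<in>Jset m n. cmod (c j))"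
    proof (rule order_trans[OF norm_sum sum_mono])
      fix j assume "j \<in> Jset m n"
      then have "cmod (\<Prod>k<m. z (j k)) \<le> 1"
        using z unfolding prod_norm[symmetric] by (intro prod_le_1) (auto simp: Jset_def Mset_def PiE_def Pi_def)
      then show "cmod (c j * (\<Prod>k<m. z (j k))) \<le> cmod (c j)"
        by (simp add: norm_mult mult_left_le)
    qed
  qed
qed (use assms in auto)

lemma pol_norm_nonneg: "0 \<le> pol_norm m n c"
  by (rule order_trans[OF norm_ge_zero cmod_le_pol_norm[of n "\<lambda>_. 0"]]) simp

lemma cmod_le_pol_norm_scaled:
  assumes R: "0 < R" and z: "\<And>i. i \<in> {1..n} \<Longrightarrow> cmod (z i) \<le> R"
  shows "cmod (\<Sum>j\<in>Jset m n. c j * (\<Prod>k<m. z (j k))) \<le> R ^ m * pol_norm m n c"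
proof -
  let ?y = "\<lambda>i. z i / complex_of_real R"
  have "(\<Prod>k<m. z (j k)) = complex_of_real R ^ m * (\<Prod>k<m. ?y (j k))" for j
    using R by (simp add: prod_dividef)
  then have "(\<Sum>j\<in>Jset m n. c j * (\<Prod>k<m. z (j k))) = complex_of_real R ^ m * (\<Sum>j\<in>Jset m n. c j * (\<Prod>k<m. ?y (j k)))"
    by (simp only: sum_distrib_left mult_ac)
  moreover have "cmod (\<Sum>j\<in>Jset m n. c j * (\<Prod>k<m. ?y (j k))) \<le> pol_norm m n c"
    using R z by (intro cmod_le_pol_norm) (simp add: norm_divide)
  ultimately show ?thesis using R by (simp add: norm_mult norm_power mult_left_mono)
qed

text \<open>If \<open>\<tau>\<close> is onto, every sign occurs twice. Otherwise a missed index
  occurs only in the first product, and flipping its sign cancels the sum.\<close>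

lemma sum_signs_prod:
  assumes \<tau>: "\<tau> \<in> PiE {..<m} (\<lambda>_. {..<m})"
  shows "(\<Sum>\<epsilon>\<in>signs {..<m}. (\<Prod>k<m. \<epsilon> k) * (\<Prod>l<m. \<epsilon> (\<tau> l))) = (if \<tau> ` {..<m} = {..<m} then 2 ^ m else 0)"
proof (cases "\<tau> ` {..<m} = {..<m}")
  case True
  then have inj: "inj_on \<tau> {..<m}" by (simp add: eq_card_imp_inj_on)
  have "(\<Prod>k<m. \<epsilon> k) * (\<Prod>l<m. \<epsilon> (\<tau> l)) = 1" if "\<epsilon> \<in> signs {..<m}" for \<epsilon> :: "nat \<Rightarrow> complex"
  proof -
    have "(\<Prod>l<m. \<epsilon> (\<tau> l)) = (\<Prod>k<m. \<epsilon> k)"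
      using prod.reindex[OF inj, of \<epsilon>] True by (simp add: o_def)
    then have "(\<Prod>k<m. \<epsilon> k) * (\<Prod>l<m. \<epsilon> (\<tau> l)) = (\<Prod>k<m. \<epsilon> k * \<epsilon> k)"
      by (simp add: prod.distrib)
    also have "\<dots> = 1"
    proof (rule prod.neutral, rule ballI)
      fix k assume "k \<in> {..<m}"
      then have "\<epsilon> k \<in> {-1, 1}" using that by (rule PiE_mem[rotated])
      then show "\<epsilon> k * \<epsilon> k = 1" by auto
    qed
    finally show ?thesis .
  qed
  then show ?thesis using True by (simp add: card_PiE)
next
  case False
  moreover have "\<tau> ` {..<m} \<subseteq> {..<m}" using \<tau> by auto
  ultimately obtain k0 where k0: "k0 < m" "k0 \<notin> \<tau> ` {..<m}" by auto
  let ?T = "{..<m} - {k0}"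
  have ins: "{..<m} = insert k0 ?T" using k0 by auto
  let ?F = "\<lambda>\<epsilon>. (\<Prod>k<m. \<epsilon> k) * (\<Prod>l<m. \<epsilon> (\<tau> l)) :: complex"
  have F: "?F (f(k0 := b)) = b * ((\<Prod>k\<in>?T. f k) * (\<Prod>l<m. f (\<tau> l)))" for f b
  proof -
    have "(\<Prod>l<m. (f(k0 := b)) (\<tau> l)) = (\<Prod>l<m. f (\<tau> l))"
      using k0(2) by (intro prod.cong) auto
    moreover have "(\<Prod>k<m. (f(k0 := b)) k) = b * (\<Prod>k\<in>?T. f k)"
    proof -
      have "(\<Prod>k\<in>?T. (f(k0 := b)) k) = (\<Prod>k\<in>?T. f k)" by (intro prod.cong) auto
      then show ?thesis using k0(1) by (simp add: prod.remove[of "{..<m}" k0])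
    qed
    ultimately show ?thesis by (simp add: mult.assoc)
  qed
  have "(\<Sum>\<epsilon>\<in>signs {..<m}. ?F \<epsilon>) = (\<Sum>\<epsilon>\<in>signs (insert k0 ?T). ?F \<epsilon>)"
    using ins by simp
  also have "\<dots> = (\<Sum>b\<in>{-1, 1}. \<Sum>f\<in>signs ?T. ?F (f(k0 := b)))"
    by (rule sum_PiE_insert) simp
  also have "\<dots> = 0" unfolding F by (simp add: sum_negf)
  finally show ?thesis using False by simp
qed

text \<open>A change of encoding: maps in \<open>PiE\<close> are \<open>undefined\<close> outside
  \<open>{..<m}\<close>, whereas permutations are the identity there.\<close>

lemma sum_surjections_eq_sum_permutations:
  fixes m :: nat
  shows "(\<Sum>\<tau>\<in>PiE {..<m} (\<lambda>_. {..<m}). (if \<tau> ` {..<m} = {..<m} then F \<tau> else 0))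
    = (\<Sum>\<sigma> | \<sigma> permutes {..<m}. F (restrict \<sigma> {..<m}))"
proof -
  have "(\<Sum>\<tau>\<in>PiE {..<m} (\<lambda>_. {..<m}). (if \<tau> ` {..<m} = {..<m} then F \<tau> else 0))
    = (\<Sum>\<tau> | \<tau> \<in> PiE {..<m} (\<lambda>_. {..<m}) \<and> \<tau> ` {..<m} = {..<m}. F \<tau>)"
    by (rule sum.inter_filter[symmetric]) (intro finite_PiE; simp)
  also have "\<dots> = (\<Sum>\<sigma> | \<sigma> permutes {..<m}. F (restrict \<sigma> {..<m}))"
  proof (rule sum.reindex_bij_witness[where i = "\<lambda>\<sigma>. restrict \<sigma> {..<m}" and j = "\<lambda>\<tau> k. if k < m then \<tau> k else k"])
    fix \<tau> assume \<tau>: "\<tau> \<in> {\<tau>. \<tau> \<in> PiE {..<m} (\<lambda>_. {..<m}) \<and> \<tau> ` {..<m} = {..<m}}"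
    then show r: "restrict (\<lambda>k. if k < m then \<tau> k else k) {..<m} = \<tau>"
      by (auto simp: fun_eq_iff PiE_def extensional_def)
    have "inj_on \<tau> {..<m}" using \<tau> by (simp add: eq_card_imp_inj_on)
    then have "bij_betw \<tau> {..<m} {..<m}" using \<tau> by (simp add: bij_betw_def)
    then have "bij_betw (\<lambda>k. if k < m then \<tau> k else k) {..<m} {..<m}"
      by (rule bij_betw_cong[THEN iffD1, rotated]) auto
    then show "(\<lambda>k. if k < m then \<tau> k else k) \<in> {\<sigma>. \<sigma> permutes {..<m}}"
      unfolding mem_Collect_eq by (rule bij_imp_permutes) simp
    show "F (restrict (\<lambda>k. if k < m then \<tau> k else k) {..<m}) = F \<tau>" by (simp only: r)
  next
    fix \<sigma> assume \<sigma>: "\<sigma> \<in> {\<sigma>. \<sigma> permutes {..<m}}"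
    then show "(\<lambda>k. if k < m then restrict \<sigma> {..<m} k else k) = \<sigma>"
      by (auto simp: fun_eq_iff permutes_def)
    have "restrict \<sigma> {..<m} ` {..<m} = {..<m}" using \<sigma> permutes_image[of \<sigma> "{..<m}"] by simp
    then show "restrict \<sigma> {..<m} \<in> {\<tau>. \<tau> \<in> PiE {..<m} (\<lambda>_. {..<m}) \<and> \<tau> ` {..<m} = {..<m}}"
      using \<sigma> permutes_in_image[of \<sigma> "{..<m}"] by auto
  qed
  finally show ?thesis .
qed

text \<open>Coefficients of the symmetric form belonging to the polynomial. All permutations that
  sort \<open>i\<close> count, including those exchanging equal entries, so multiplicities need no
  separate bookkeeping.\<close>

definition symmetrized :: "nat \<Rightarrow> nat \<Rightarrow> ((nat \<Rightarrow> nat) \<Rightarrow> complex) \<Rightarrow> (nat \<Rightarrow> nat) \<Rightarrow> complex" where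
  "symmetrized m n c i = (\<Sum>\<sigma> | \<sigma> permutes {..<m}. if i \<circ> \<sigma> \<in> Jset m n then c (i \<circ> \<sigma>) else 0) / fact m"

lemma Mset_permute: "i \<in> Mset m n \<Longrightarrow> \<sigma> permutes {..<m} \<Longrightarrow> i \<circ> \<sigma> \<in> Mset m n"
  by (auto simp: Mset_def PiE_def Pi_def extensional_def permutes_in_image[of \<sigma> "{..<m}", simplified])

text \<open>Expanding the product on the right gives one term per map \<open>\<tau>\<close> of
  positions. The signs remove the non-bijective ones, and the permutations that remain reassemble
  the symmetric form.\<close>

lemma polarization:
  "2 ^ m * fact m * (\<Sum>i\<in>Mset m n. symmetrized m n c i * (\<Prod>k<m. x k (i k)))
    = (\<Sum>\<epsilon>\<in>signs {..<m}. (\<Prod>k<m. \<epsilon> k) * (\<Sum>j\<in>Jset m n. c j * (\<Prod>l<m. \<Sum>k<m. \<epsilon> k * x k (j l))))"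
proof -
  define d where "d j = (if j \<in> Jset m n then c j else 0)" for j
  have J: "(\<Sum>j\<in>Jset m n. c j * G j) = (\<Sum>j\<in>Mset m n. d j * G j)" for G
    by (rule sum.mono_neutral_cong_left) (auto simp: Jset_def d_def)
  have "fact m * (\<Sum>i\<in>Mset m n. symmetrized m n c i * (\<Prod>k<m. x k (i k)))
      = (\<Sum>i\<in>Mset m n. \<Sum>\<sigma> | \<sigma> permutes {..<m}. d (i \<circ> \<sigma>) * (\<Prod>k<m. x k (i k)))"
  proof -
    have "fact m * symmetrized m n c i = (\<Sum>\<sigma> | \<sigma> permutes {..<m}. d (i \<circ> \<sigma>))" for i
      by (simp add: symmetrized_def d_def)
    then have "fact m * (symmetrized m n c i * (\<Prod>k<m. x k (i k)))
        = (\<Sum>\<sigma> | \<sigma> permutes {..<m}. d (i \<circ> \<sigma>)) * (\<Prod>k<m. x k (i k))" for i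
      by (simp only: mult.assoc[symmetric])
    then show ?thesis by (simp only: sum_distrib_left sum_distrib_right)
  qed
  also have "\<dots> = (\<Sum>\<sigma> | \<sigma> permutes {..<m}. \<Sum>i\<in>Mset m n. d (i \<circ> \<sigma>) * (\<Prod>k<m. x k (i k)))"
    by (rule sum.swap)
  also have "\<dots> = (\<Sum>\<sigma> | \<sigma> permutes {..<m}. \<Sum>j\<in>Mset m n. d j * (\<Prod>l<m. x (\<sigma> l) (j l)))"
  proof (rule sum.cong[OF refl])
    fix \<sigma> assume "\<sigma> \<in> {\<sigma>. \<sigma> permutes {..<m}}"
    then have \<sigma>: "\<sigma> permutes {..<m}" by simp
    show "(\<Sum>i\<in>Mset m n. d (i \<circ> \<sigma>) * (\<Prod>k<m. x k (i k))) = (\<Sum>j\<in>Mset m n. d j * (\<Prod>l<m. x (\<sigma> l) (j l)))"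
    proof (rule sum.reindex_bij_witness[where i = "\<lambda>j. j \<circ> inv \<sigma>" and j = "\<lambda>i. i \<circ> \<sigma>"])
      fix i assume "i \<in> Mset m n"
      then show "i \<circ> \<sigma> \<in> Mset m n" using \<sigma> by (rule Mset_permute)
      show "i \<circ> \<sigma> \<circ> inv \<sigma> = i" using permutes_inv_o(1)[OF \<sigma>] by (simp add: o_assoc[symmetric])
      have "(\<Prod>l<m. x (\<sigma> l) ((i \<circ> \<sigma>) l)) = (\<Prod>k<m. x k (i k))"
        using prod.permute[OF \<sigma>, of "\<lambda>k. x k (i k)"] by (simp add: o_def)
      then show "d (i \<circ> \<sigma>) * (\<Prod>l<m. x (\<sigma> l) ((i \<circ> \<sigma>) l)) = d (i \<circ> \<sigma>) * (\<Prod>k<m. x k (i k))"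
        by simp
    next
      fix j assume "j \<in> Mset m n"
      then show "j \<circ> inv \<sigma> \<in> Mset m n" using permutes_inv[OF \<sigma>] by (rule Mset_permute)
      show "j \<circ> inv \<sigma> \<circ> \<sigma> = j" using permutes_inv_o(2)[OF \<sigma>] by (simp add: o_assoc[symmetric])
    qed
  qed
  finally have L: "2 ^ m * fact m * (\<Sum>i\<in>Mset m n. symmetrized m n c i * (\<Prod>k<m. x k (i k)))
      = 2 ^ m * (\<Sum>\<sigma> | \<sigma> permutes {..<m}. \<Sum>j\<in>Mset m n. d j * (\<Prod>l<m. x (\<sigma> l) (j l)))"
    by (simp add: mult.assoc)

  let ?P = "PiE {..<m} (\<lambda>_. {..<m})"
  have exp: "(\<Prod>l<m. \<Sum>k<m. \<epsilon> k * x k (j l)) = (\<Sum>\<tau>\<in>?P. (\<Prod>l<m. \<epsilon> (\<tau> l)) * (\<Prod>l<m. x (\<tau> l) (j l)))" for \<epsilon> j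
    by (simp add: prod_sum_PiE prod.distrib)
  have "(\<Sum>\<epsilon>\<in>signs {..<m}. (\<Prod>k<m. \<epsilon> k) * (\<Sum>j\<in>Mset m n. d j * (\<Prod>l<m. \<Sum>k<m. \<epsilon> k * x k (j l))))
      = (\<Sum>\<epsilon>\<in>signs {..<m}. \<Sum>j\<in>Mset m n. \<Sum>\<tau>\<in>?P. ((\<Prod>k<m. \<epsilon> k) * (\<Prod>l<m. \<epsilon> (\<tau> l))) * (d j * (\<Prod>l<m. x (\<tau> l) (j l))))"
    unfolding exp by (simp only: sum_distrib_left mult_ac)
  also have "\<dots> = (\<Sum>j\<in>Mset m n. \<Sum>\<tau>\<in>?P. \<Sum>\<epsilon>\<in>signs {..<m}. ((\<Prod>k<m. \<epsilon> k) * (\<Prod>l<m. \<epsilon> (\<tau> l))) * (d j * (\<Prod>l<m. x (\<tau> l) (j l))))"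
    by (rule trans[OF sum.swap]) (intro sum.cong refl sum.swap)
  also have "\<dots> = (\<Sum>j\<in>Mset m n. \<Sum>\<tau>\<in>?P. if \<tau> ` {..<m} = {..<m} then 2 ^ m * (d j * (\<Prod>l<m. x (\<tau> l) (j l))) else 0)"
    unfolding sum_distrib_right[symmetric] by (intro sum.cong refl) (simp add: sum_signs_prod)
  also have "\<dots> = (\<Sum>j\<in>Mset m n. \<Sum>\<sigma> | \<sigma> permutes {..<m}. 2 ^ m * (d j * (\<Prod>l<m. x (\<sigma> l) (j l))))"
    unfolding sum_surjections_eq_sum_permutations by (intro sum.cong refl) simp
  also have "\<dots> = 2 ^ m * (\<Sum>\<sigma> | \<sigma> permutes {..<m}. \<Sum>j\<in>Mset m n. d j * (\<Prod>l<m. x (\<sigma> l) (j l)))"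
    by (subst sum.swap) (simp only: sum_distrib_left)
  finally show ?thesis unfolding J L by simp
qed

text \<open>A signed sum of \<open>m\<close> admissible arguments has sup norm at most
  \<open>m\<close>, whence \<open>m^m\<close> by homogeneity. The number \<open>2 ^ m\<close> of
  sign choices cancels, and \<open>fact m\<close> is bounded below by 1.\<close>

lemma mult_norm_symmetrized:
  assumes m: "1 \<le> m"
  shows "mult_norm m n (symmetrized m n c) \<le> real m ^ m * pol_norm m n c"
  unfolding mult_norm_def
proof (rule cSUP_least)
  show "{x :: nat \<Rightarrow> nat \<Rightarrow> complex. \<forall>k<m. \<forall>i\<in>{1..n}. cmod (x k i) \<le> 1} \<noteq> {}"
    unfolding ex_in_conv[symmetric] by (rule exI[of _ "\<lambda>_ _. 0"]) simp
next
  fix x :: "nat \<Rightarrow> nat \<Rightarrow> complex" assume x: "x \<in> {x. \<forall>k<m. \<forall>i\<in>{1..n}. cmod (x k i) \<le> 1}"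
  let ?A = "\<Sum>i\<in>Mset m n. symmetrized m n c i * (\<Prod>k<m. x k (i k))"
  have "2 ^ m * fact m * cmod ?A = cmod (2 ^ m * fact m * ?A)"
    by (simp add: norm_mult norm_power)
  also have "\<dots> \<le> (\<Sum>\<epsilon>\<in>signs {..<m}. real m ^ m * pol_norm m n c)"
    unfolding polarization
  proof (rule sum_norm_le)
    fix \<epsilon> :: "nat \<Rightarrow> complex" assume \<epsilon>: "\<epsilon> \<in> signs {..<m}"
    then have e1: "cmod (\<epsilon> k) = 1" if "k < m" for k using that by (auto simp: PiE_def Pi_def)
    have "cmod (\<Prod>k<m. \<epsilon> k) = 1" unfolding prod_norm[symmetric] using e1 by (intro prod.neutral) auto
    moreover have "cmod (\<Sum>j\<in>Jset m n. c j * (\<Prod>l<m. \<Sum>k<m. \<epsilon> k * x k (j l))) \<le> real m ^ m * pol_norm m n c"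
    proof (rule cmod_le_pol_norm_scaled[where z = "\<lambda>i. \<Sum>k<m. \<epsilon> k * x k i"])
      fix i assume "i \<in> {1..n}"
      then have "cmod (\<Sum>k<m. \<epsilon> k * x k i) \<le> (\<Sum>k<m. 1)"
        using x e1 by (intro sum_norm_le) (simp add: norm_mult)
      then show "cmod (\<Sum>k<m. \<epsilon> k * x k i) \<le> real m" by simp
    qed (use m in simp)
    ultimately show "cmod ((\<Prod>k<m. \<epsilon> k) * (\<Sum>j\<in>Jset m n. c j * (\<Prod>l<m. \<Sum>k<m. \<epsilon> k * x k (j l)))) \<le> real m ^ m * pol_norm m n c"
      by (simp add: norm_mult)
  qed
  also have "\<dots> = 2 ^ m * (real m ^ m * pol_norm m n c)" by (simp add: card_PiE)
  finally have "fact m * cmod ?A \<le> real m ^ m * pol_norm m n c" by (simp add: mult.assoc)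
  moreover have "1 * cmod ?A \<le> fact m * cmod ?A" by (intro mult_right_mono) auto
  ultimately show "cmod ?A \<le> real m ^ m * pol_norm m n c" by linarith
qed

text \<open>Two sorted lists with the same multiset of values coincide.\<close>

lemma Jset_permute_eq:
  assumes j: "j \<in> Jset m n" "j \<circ> \<sigma> \<in> Jset m n" and \<sigma>: "\<sigma> permutes {..<m}"
  shows "j \<circ> \<sigma> = j"
proof -
  have sorted: "sorted (map i [0..<m])" if "i \<in> Jset m n" for i
    using that by (auto simp: sorted_iff_nth_Suc Jset_def)
  have "mset (map (j \<circ> \<sigma>) [0..<m]) = image_mset j (image_mset \<sigma> (mset_set {..<m}))"
    by (simp add: lessThan_atLeast0 multiset.map_comp)
  also have "image_mset \<sigma> (mset_set {..<m}) = mset_set {..<m}"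
    using \<sigma> by (rule permutes_image_mset)
  also have "image_mset j \<dots> = mset (map j [0..<m])" by (simp add: lessThan_atLeast0)
  finally have "map (j \<circ> \<sigma>) [0..<m] = map j [0..<m]"
    using sorted[OF j(1)] sorted[OF j(2)] by (metis properties_for_sort)
  then have "(j \<circ> \<sigma>) k = j k" if "k < m" for k using that by (simp add: map_eq_conv)
  moreover have "(j \<circ> \<sigma>) k = j k" if "\<not> k < m" for k using permutes_not_in[OF \<sigma>, of k] that by simp
  ultimately show ?thesis by (auto simp: fun_eq_iff)
qed

text \<open>At a sorted tuple all surviving permutations produce the same coefficient, so nothing
  cancels, and the identity is among them.\<close>

lemma cmod_le_symmetrized:
  assumes j: "j \<in> Jset m n"
  shows "cmod (c j) \<le> fact m * cmod (symmetrized m n c j)"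
proof -
  let ?S = "{\<sigma>. \<sigma> permutes {..<m} \<and> j \<circ> \<sigma> \<in> Jset m n}"
  have fin: "finite {\<sigma>. \<sigma> permutes {..<m}}" by (simp add: finite_permutations)
  then have finS: "finite ?S" by (rule rev_finite_subset) auto
  have "fact m * symmetrized m n c j = (\<Sum>\<sigma>\<in>?S. c (j \<circ> \<sigma>))"
    using fin by (simp add: symmetrized_def sum.If_cases Int_def)
  also have "\<dots> = (\<Sum>\<sigma>\<in>?S. c j)" by (intro sum.cong refl arg_cong[of _ _ c] Jset_permute_eq[OF j]) auto
  also have "\<dots> = of_nat (card ?S) * c j" by simp
  finally have "fact m * cmod (symmetrized m n c j) = real (card ?S) * cmod (c j)"
    by (metis norm_fact norm_mult norm_of_nat)
  moreover have "id \<in> ?S" using j by (simp add: permutes_id)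
  then have "1 \<le> card ?S" using finS by (metis One_nat_def Suc_leI card_gt_0_iff empty_iff)
  then have "1 * cmod (c j) \<le> real (card ?S) * cmod (c j)" by (intro mult_right_mono) auto
  ultimately show ?thesis by simp
qed

section \<open>Forms with unimodular coefficients\<close>

lemma fin_rearr_unimodular:
  assumes I: "finite I" and x: "\<And>i. i \<in> I \<Longrightarrow> x i = 0 \<or> cmod (x i) = 1"
    and N: "card {i \<in> I. x i \<noteq> 0} = N"
  shows "fin_rearr I x = initial_indicator N"
proof -
  have "decr I x k = (if k < N then 1 else 0)" for k
  proof (rule ennreal_eqI_less)
    fix t
    show "t < decr I x k \<longleftrightarrow> t < (if k < N then 1 else 0)"
    proof
      assume "t < decr I x k"
      then obtain B where B: "B \<subseteq> I" "finite B" "card B = Suc k" "\<forall>i\<in>B. t < ennreal (cmod (x i))"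
        unfolding less_decr_iff by blast
      have sub: "B \<subseteq> {i \<in> I. x i \<noteq> 0}" using B by auto
      then have "Suc k \<le> N" using B(3) N I card_mono[OF _ sub] by auto
      moreover obtain i where "i \<in> B" using B(3) by (metis card.empty ex_in_conv nat.distinct(1))
      then have "t < ennreal (cmod (x i))" "cmod (x i) = 1" using B sub x[of i] by auto
      then have "t < 1" by simp
      ultimately show "t < (if k < N then 1 else 0)" by simp
    next
      assume t: "t < (if k < N then 1 else 0)"
      then have "k < N" by (cases "k < N") auto
      then obtain B where B: "B \<subseteq> {i \<in> I. x i \<noteq> 0}" "card B = Suc k" "finite B"
        using obtain_subset_with_card_n[of "Suc k" "{i \<in> I. x i \<noteq> 0}"] N by (metis Suc_leI)
      then have "\<forall>i\<in>B. t < ennreal (cmod (x i))" using x t \<open>k < N\<close> by fastforce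
      then show "t < decr I x k" unfolding less_decr_iff using B by blast
    qed
  qed
  then show ?thesis by (auto simp: fin_rearr_def initial_indicator_def)
qed

section \<open>The Fourier matrix and its iterates\<close>

definition fourier :: "nat \<Rightarrow> nat \<Rightarrow> nat \<Rightarrow> complex" where
  "fourier n u v = cis (2 * pi * real u * real v / real n)"

lemma cmod_fourier [simp]: "cmod (fourier n u v) = 1"
  by (simp add: fourier_def)

lemma sum_roots_of_unity:
  fixes z :: complex
  assumes "z ^ n = 1" "z \<noteq> 1"
  shows "(\<Sum>v\<in>{1..n}. z ^ v) = 0"
proof -
  have "(\<Sum>v\<in>{1..n}. z ^ v) = (\<Sum>v<n. z ^ Suc v)"
    by (rule sum.reindex_bij_witness[where i = Suc and j = "\<lambda>v. v - 1"]) auto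
  also have "\<dots> = z * (\<Sum>v<n. z ^ v)" by (simp add: sum_distrib_left)
  also have "(\<Sum>v<n. z ^ v) = 0" using assms by (simp add: sum_gp_strict)
  finally show ?thesis by simp
qed

lemma fourier_orthogonal:
  assumes "u \<in> {1..n}" "u' \<in> {1..n}" "u \<noteq> u'"
  shows "(\<Sum>v\<in>{1..n}. fourier n u v * cnj (fourier n u' v)) = 0"
proof -
  define z where "z = cis (2 * pi * (real u - real u') / real n)"
  have n: "0 < n" using assms by auto
  have "fourier n u v * cnj (fourier n u' v) = z ^ v" for v
  proof -
    have "fourier n u v * cnj (fourier n u' v) = cis (2 * pi * real u * real v / real n - 2 * pi * real u' * real v / real n)"
      by (simp add: fourier_def cis_cnj cis_mult)
    also have "2 * pi * real u * real v / real n - 2 * pi * real u' * real v / real n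
        = real v * (2 * pi * (real u - real u') / real n)"
      using n by (simp add: field_simps)
    finally show ?thesis unfolding z_def Complex.DeMoivre .
  qed
  moreover have "z ^ n = 1"
  proof -
    have "z ^ n = cis (2 * pi * (real_of_int (int u - int u')))"
      using n by (simp add: z_def Complex.DeMoivre)
    then show ?thesis by (simp only: cis_multiple_2pi Ints_of_int)
  qed
  \<comment> \<open>Otherwise \<open>n\<close> would divide \<open>u - u'\<close>, which is nonzero
    and smaller than \<open>n\<close> in absolute value.\<close>
  moreover have "z \<noteq> 1"
  proof
    assume "z = 1"
    then have "exp (\<i> * complex_of_real (2 * pi * (real u - real u') / real n)) = 1"
      by (simp add: z_def cis_conv_exp)
    then obtain k :: int where "2 * pi * (real u - real u') / real n = real_of_int (2 * k) * pi"
      by (auto simp: exp_eq_1)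
    then have "2 * pi * (real u - real u') = 2 * pi * (real_of_int k * real n)" using n by (simp add: field_simps)
    then have "real u - real u' = real_of_int k * real n" by (subst (asm) mult_cancel_left) simp
    then have "int u - int u' = k * int n"
      by (metis of_int_eq_iff of_int_diff of_int_mult of_int_of_nat_eq)
    moreover have "\<bar>int u - int u'\<bar> < int n" using assms by auto
    ultimately show False
      using assms(3) n by (cases "k = 0") (auto simp: abs_mult mult_less_cancel_right1)
  qed
  ultimately show ?thesis using sum_roots_of_unity by simp
qed

lemma fourier_parseval:
  "(\<Sum>v\<in>{1..n}. (cmod (\<Sum>u\<in>{1..n}. y u * fourier n u v))\<^sup>2) = real n * (\<Sum>u\<in>{1..n}. (cmod (y u))\<^sup>2)"
proof -
  let ?I = "{1..n}"
  have "complex_of_real (\<Sum>v\<in>?I. (cmod (\<Sum>u\<in>?I. y u * fourier n u v))\<^sup>2)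
      = (\<Sum>v\<in>?I. (\<Sum>u\<in>?I. y u * fourier n u v) * cnj (\<Sum>u\<in>?I. y u * fourier n u v))"
    by (simp only: of_real_sum complex_norm_square)
  also have "\<dots> = (\<Sum>v\<in>?I. \<Sum>u\<in>?I. \<Sum>u'\<in>?I. y u * cnj (y u') * (fourier n u v * cnj (fourier n u' v)))"
    by (simp add: sum_product mult_ac)
  also have "\<dots> = (\<Sum>u\<in>?I. \<Sum>u'\<in>?I. \<Sum>v\<in>?I. y u * cnj (y u') * (fourier n u v * cnj (fourier n u' v)))"
    by (rule trans[OF sum.swap]) (intro sum.cong refl sum.swap)
  also have "\<dots> = (\<Sum>u\<in>?I. \<Sum>u'\<in>?I. if u' = u then y u * cnj (y u) * of_nat n else 0)"
  proof (intro sum.cong refl)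
    fix u u' assume uu: "u \<in> ?I" "u' \<in> ?I"
    show "(\<Sum>v\<in>?I. y u * cnj (y u') * (fourier n u v * cnj (fourier n u' v)))
      = (if u' = u then y u * cnj (y u) * of_nat n else 0)"
    proof (cases "u' = u")
      case True
      have "fourier n u v * cnj (fourier n u v) = 1" for v
        by (simp flip: complex_norm_square)
      then show ?thesis using True by simp
    next
      case False
      then show ?thesis
        using fourier_orthogonal[OF uu] unfolding sum_distrib_left[symmetric] by simp
    qed
  qed
  also have "\<dots> = (\<Sum>u\<in>?I. y u * cnj (y u) * of_nat n)" by simp
  also have "\<dots> = complex_of_real (real n * (\<Sum>u\<in>?I. (cmod (y u))\<^sup>2))"
    by (simp add: sum_distrib_left mult.commute flip: complex_norm_square)
  finally show ?thesis by (simp only: of_real_eq_iff)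
qed

definition fourier_matrix :: "nat \<Rightarrow> nat \<Rightarrow> (nat \<Rightarrow> nat) \<Rightarrow> complex" where
  "fourier_matrix m n i = (\<Prod>k<m - 1. fourier n (i k) (i (Suc k)))"

lemma cmod_fourier_matrix [simp]: "cmod (fourier_matrix m n i) = 1"
  by (simp add: fourier_matrix_def flip: prod_norm)

text \<open>Partial sums of the form with the next variable frozen at \<open>v\<close>. The update
  \<open>i(m := v)\<close> supplies the endpoint of the last factor, and \<open>m = 0\<close> gives
  the constant 1.\<close>

definition fourier_chain :: "nat \<Rightarrow> (nat \<Rightarrow> nat \<Rightarrow> complex) \<Rightarrow> nat \<Rightarrow> nat \<Rightarrow> complex" where
  "fourier_chain n x m v =
    (\<Sum>i\<in>Mset m n. (\<Prod>k<m. x k (i k)) * (\<Prod>k<m. fourier n (i k) ((i(m := v)) (Suc k))))"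

lemma Mset_Suc:
  "(\<Sum>i\<in>Mset (Suc m) n. F i) = (\<Sum>u\<in>{1..n}. \<Sum>i\<in>Mset m n. F (i(m := u)))"
  using sum_PiE_insert[where j = m and J = "{..<m}" and F = F and B = "\<lambda>_. {1..n}"]
  by (simp only: Mset_def lessThan_Suc lessThan_iff simp_thms less_irrefl)

text \<open>One step is multiplication by \<open>x m\<close> followed by a Fourier
  transform.\<close>

lemma fourier_chain_Suc:
  "fourier_chain n x (Suc m) v = (\<Sum>u\<in>{1..n}. x m u * fourier_chain n x m u * fourier n u v)"
proof -
  have "(\<Prod>k<m. x k ((i(m := u)) k)) = (\<Prod>k<m. x k (i k))" for i u
    by (intro prod.cong) auto
  moreover have "(\<Prod>k<m. fourier n ((i(m := u)) k) ((i(m := u, Suc m := v)) (Suc k)))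
      = (\<Prod>k<m. fourier n (i k) ((i(m := u)) (Suc k)))" for i u
    by (intro prod.cong) auto
  ultimately show ?thesis
    unfolding fourier_chain_def Mset_Suc prod.lessThan_Suc by (simp add: sum_distrib_left sum_distrib_right mult_ac)
qed

lemma fourier_matrix_sum_eq:
  "(\<Sum>i\<in>Mset (Suc m) n. fourier_matrix (Suc m) n i * (\<Prod>k<Suc m. x k (i k)))
    = (\<Sum>u\<in>{1..n}. x m u * fourier_chain n x m u)"
proof -
  have "(\<Prod>k<m. x k ((i(m := u)) k)) = (\<Prod>k<m. x k (i k))" for i u
    by (intro prod.cong) auto
  moreover have "(\<Prod>k<m. fourier n ((i(m := u)) k) ((i(m := u)) (Suc k)))
      = (\<Prod>k<m. fourier n (i k) ((i(m := u)) (Suc k)))" for i u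
    by (intro prod.cong) auto
  ultimately show ?thesis
    unfolding fourier_chain_def Mset_Suc prod.lessThan_Suc fourier_matrix_def by (simp add: sum_distrib_left mult_ac)
qed

text \<open>Multiplication by \<open>x k\<close> does not increase the \<open>l2\<close> norm, and
  each transform multiplies its square by \<open>n\<close>. The start is the constant 1, whose
  squared norm is \<open>n\<close>.\<close>

lemma fourier_chain_norm:
  assumes "\<And>k i. k < m \<Longrightarrow> i \<in> {1..n} \<Longrightarrow> cmod (x k i) \<le> 1"
  shows "(\<Sum>v\<in>{1..n}. (cmod (fourier_chain n x m v))\<^sup>2) \<le> real n ^ Suc m"
  using assms
proof (induction m)
  case 0
  then show ?case by (simp add: fourier_chain_def Mset_def)
next
  case (Suc m)
  have "(\<Sum>v\<in>{1..n}. (cmod (fourier_chain n x (Suc m) v))\<^sup>2) = real n * (\<Sum>u\<in>{1..n}. (cmod (x m u * fourier_chain n x m u))\<^sup>2)"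
    unfolding fourier_chain_Suc by (rule fourier_parseval)
  also have "\<dots> \<le> real n * (\<Sum>u\<in>{1..n}. (cmod (fourier_chain n x m u))\<^sup>2)"
    using Suc.prems[of m]
    by (intro mult_left_mono sum_mono power_mono) (auto simp: norm_mult mult_left_le_one_le)
  also have "\<dots> \<le> real n * real n ^ Suc m"
    using Suc by (intro mult_left_mono) auto
  finally show ?case by simp
qed

text \<open>Only \<open>m - 1\<close> transforms occur; the last variable is summed by
  Cauchy-Schwarz, at the price of one more factor \<open>n\<close> in the square.\<close>

lemma fourier_matrix_bound:
  assumes m: "1 \<le> m" and x: "\<And>k i. k < m \<Longrightarrow> i \<in> {1..n} \<Longrightarrow> cmod (x k i) \<le> 1"
  shows "cmod (\<Sum>i\<in>Mset m n. fourier_matrix m n i * (\<Prod>k<m. x k (i k))) \<le> sqrt (real n ^ (m + 1))"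
proof (rule real_le_rsqrt)
  obtain l where l: "m = Suc l" using m by (cases m) auto
  let ?T = "fourier_chain n x l"
  have "cmod (\<Sum>u\<in>{1..n}. x l u * ?T u) \<le> (\<Sum>u\<in>{1..n}. \<bar>1\<bar> * \<bar>cmod (?T u)\<bar>)"
    using x[of l] l by (intro sum_norm_le) (auto simp: norm_mult mult_left_le_one_le)
  also have "\<dots> \<le> L2_set (\<lambda>_. 1) {1..n} * L2_set (\<lambda>u. cmod (?T u)) {1..n}"
    by (rule L2_set_mult_ineq)
  finally have "(cmod (\<Sum>u\<in>{1..n}. x l u * ?T u))\<^sup>2 \<le> (L2_set (\<lambda>_. 1) {1..n} * L2_set (\<lambda>u. cmod (?T u)) {1..n})\<^sup>2"
    by (intro power_mono) auto
  also have "\<dots> = real n * (\<Sum>u\<in>{1..n}. (cmod (?T u))\<^sup>2)"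
    by (simp add: L2_set_def power_mult_distrib sum_nonneg)
  also have "\<dots> \<le> real n * real n ^ Suc l"
    using x l by (intro mult_left_mono fourier_chain_norm) auto
  finally show "(cmod (\<Sum>i\<in>Mset m n. fourier_matrix m n i * (\<Prod>k<m. x k (i k))))\<^sup>2 \<le> real n ^ (m + 1)"
    unfolding l fourier_matrix_sum_eq by simp
qed

lemma mult_norm_fourier_matrix:
  assumes "1 \<le> m"
  shows "mult_norm m n (fourier_matrix m n) \<le> sqrt (real n ^ (m + 1))"
  unfolding mult_norm_def
proof (rule cSUP_least)
  have "(\<lambda>_ _. 0) \<in> {x :: nat \<Rightarrow> nat \<Rightarrow> complex. \<forall>k<m. \<forall>i\<in>{1..n}. cmod (x k i) \<le> 1}" by simp
  then show "{x :: nat \<Rightarrow> nat \<Rightarrow> complex. \<forall>k<m. \<forall>i\<in>{1..n}. cmod (x k i) \<le> 1} \<noteq> {}"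
    unfolding ex_in_conv[symmetric] by (rule exI[of _ "\<lambda>_ _. 0"])
qed (use fourier_matrix_bound[OF assms] in auto)

lemma card_Mset: "card (Mset m n) = n ^ m"
  by (simp add: Mset_def card_PiE)

lemma fin_rearr_fourier_matrix: "fin_rearr (Mset m n) (fourier_matrix m n) = initial_indicator (n ^ m)"
proof (rule fin_rearr_unimodular)
  have "fourier_matrix m n i \<noteq> 0" for i by (metis cmod_fourier_matrix norm_zero zero_neq_one)
  then show "card {i \<in> Mset m n. fourier_matrix m n i \<noteq> 0} = n ^ m"
    by (simp add: card_Mset)
qed auto

text \<open>The variables of the polynomial are split into \<open>m\<close> consecutive blocks of length \<open>n\<close>,
  the \<open>k\<close>-th block being fed into the \<open>k\<close>-th argument of the multilinear form.\<close>

definition block_index :: "nat \<Rightarrow> nat \<Rightarrow> (nat \<Rightarrow> nat) \<Rightarrow> nat \<Rightarrow> nat" where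
  "block_index m n i = (\<lambda>k\<in>{..<m}. i k + n * k)"

definition block_unindex :: "nat \<Rightarrow> nat \<Rightarrow> (nat \<Rightarrow> nat) \<Rightarrow> nat \<Rightarrow> nat" where
  "block_unindex m n j = (\<lambda>k\<in>{..<m}. j k - n * k)"

definition block_coeff :: "nat \<Rightarrow> nat \<Rightarrow> (nat \<Rightarrow> nat) \<Rightarrow> complex" where
  "block_coeff m n j = (if j \<in> block_index m n ` Mset m n then fourier_matrix m n (block_unindex m n j) else 0)"

lemma block_unindex_index: "i \<in> Mset m n \<Longrightarrow> block_unindex m n (block_index m n i) = i"
  by (auto simp: block_unindex_def block_index_def Mset_def fun_eq_iff PiE_def extensional_def)

lemma inj_block_index: "inj_on (block_index m n) (Mset m n)"
  by (metis block_unindex_index inj_on_inverseI)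

text \<open>Position \<open>k\<close> takes its index in block \<open>k\<close>, and the blocks are
  consecutive, so the tuples are increasing without being sorted.\<close>

lemma block_index_Jset: "block_index m n ` Mset m n \<subseteq> Jset m (m * n)"
proof
  fix j assume "j \<in> block_index m n ` Mset m n"
  then obtain i where i: "i \<in> Mset m n" "j = block_index m n i" by blast
  have ik: "1 \<le> i k" "i k \<le> n" if "k < m" for k using i(1) that by (auto simp: Mset_def PiE_def Pi_def)
  have "j \<in> Mset m (m * n)"
  proof -
    have "i k + n * k \<le> m * n" if "k < m" for k
    proof -
      have "i k + n * k \<le> n * Suc k" using ik[OF that] by simp
      also have "\<dots> \<le> n * m" using that by (intro mult_le_mono2) simp
      finally show ?thesis by (simp add: mult.commute)
    qed
    moreover have "1 \<le> i k + n * k" if "k < m" for k using ik(1)[OF that] by simp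
    ultimately show ?thesis unfolding i(2) Mset_def block_index_def by (intro restrict_PiE_iff[THEN iffD2]) simp
  qed
  moreover have "j k \<le> j (Suc k)" if "Suc k < m" for k
    using that ik[of k] by (simp add: i(2) block_index_def)
  ultimately show "j \<in> Jset m (m * n)" by (simp add: Jset_def)
qed

lemma block_polynomial_eq:
  "(\<Sum>j\<in>Jset m (m * n). block_coeff m n j * (\<Prod>k<m. z (j k)))
    = (\<Sum>i\<in>Mset m n. fourier_matrix m n i * (\<Prod>k<m. z (i k + n * k)))"
proof -
  have "(\<Sum>j\<in>Jset m (m * n). block_coeff m n j * (\<Prod>k<m. z (j k)))
      = (\<Sum>j\<in>block_index m n ` Mset m n. block_coeff m n j * (\<Prod>k<m. z (j k)))"
    using block_index_Jset by (intro sum.mono_neutral_right) (auto simp: block_coeff_def)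
  also have "\<dots> = (\<Sum>i\<in>Mset m n. block_coeff m n (block_index m n i) * (\<Prod>k<m. z (block_index m n i k)))"
    by (rule sum.reindex_cong[OF inj_block_index]) auto
  also have "\<dots> = (\<Sum>i\<in>Mset m n. fourier_matrix m n i * (\<Prod>k<m. z (i k + n * k)))"
  proof (rule sum.cong[OF refl])
    fix i assume "i \<in> Mset m n"
    moreover have "(\<Prod>k<m. z (block_index m n i k)) = (\<Prod>k<m. z (i k + n * k))"
      by (intro prod.cong) (auto simp: block_index_def)
    ultimately show "block_coeff m n (block_index m n i) * (\<Prod>k<m. z (block_index m n i k))
      = fourier_matrix m n i * (\<Prod>k<m. z (i k + n * k))"
      by (simp add: block_coeff_def block_unindex_index)
  qed
  finally show ?thesis .
qed

text \<open>Reading block \<open>k\<close> of \<open>z\<close> as argument \<open>k\<close> makes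
  the polynomial a value of the form. Having \<open>m * n\<close> variables is harmless, since the
  constant in \<open>BH_pol\<close> is uniform in their number.\<close>

lemma pol_norm_block_coeff:
  assumes "1 \<le> m"
  shows "pol_norm m (m * n) (block_coeff m n) \<le> sqrt (real n ^ (m + 1))"
  unfolding pol_norm_def
proof (rule cSUP_least)
  have "(\<lambda>_. 0) \<in> {z :: nat \<Rightarrow> complex. \<forall>i\<in>{1..m * n}. cmod (z i) \<le> 1}" by simp
  then show "{z :: nat \<Rightarrow> complex. \<forall>i\<in>{1..m * n}. cmod (z i) \<le> 1} \<noteq> {}"
    unfolding ex_in_conv[symmetric] by (rule exI[of _ "\<lambda>_. 0"])
next
  fix z :: "nat \<Rightarrow> complex" assume z: "z \<in> {z. \<forall>i\<in>{1..m * n}. cmod (z i) \<le> 1}"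
  have "cmod (z (i + n * k)) \<le> 1" if "k < m" "i \<in> {1..n}" for k i
  proof -
    have "i + n * k \<le> n * Suc k" using that by simp
    also have "\<dots> \<le> n * m" using that by (intro mult_le_mono2) simp
    finally have "i + n * k \<in> {1..m * n}" using that by (simp add: mult.commute)
    then show ?thesis using z by blast
  qed
  then show "cmod (\<Sum>j\<in>Jset m (m * n). block_coeff m n j * (\<Prod>k<m. z (j k))) \<le> sqrt (real n ^ (m + 1))"
    unfolding block_polynomial_eq using fourier_matrix_bound[OF assms, of n "\<lambda>k i. z (i + n * k)"] by blast
qed

lemma fin_rearr_block_coeff: "fin_rearr (Jset m (m * n)) (block_coeff m n) = initial_indicator (n ^ m)"
proof (rule fin_rearr_unimodular)
  have "fourier_matrix m n i \<noteq> 0" for i by (metis cmod_fourier_matrix norm_zero zero_neq_one)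
  then have "{j \<in> Jset m (m * n). block_coeff m n j \<noteq> 0} = block_index m n ` Mset m n"
    using block_index_Jset[of m n] by (auto simp: block_coeff_def)
  then show "card {j \<in> Jset m (m * n). block_coeff m n j \<noteq> 0} = n ^ m"
    by (simp add: card_image inj_block_index card_Mset)
qed (auto simp: block_coeff_def)

text \<open>The fundamental function is tested only at sizes \<open>n ^ m\<close>; this fills the
  gaps. For the least admissible \<open>n\<close>, \<open>(n - 1) ^ m\<close> is below
  \<open>N\<close>, and \<open>n <= 2 (n - 1)\<close> once \<open>n >= 2\<close>.\<close>

lemma ex_power_between:
  assumes "1 \<le> m" "1 \<le> N"
  obtains n :: nat where "N \<le> n ^ m" "n ^ m \<le> 2 ^ m * N"
proof -
  define n where "n = (LEAST n. N \<le> n ^ m)"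
  have "N \<le> N ^ m" using assms by (simp add: self_le_power)
  then have n: "N \<le> n ^ m" unfolding n_def by (rule LeastI)
  then have n0: "n \<noteq> 0" using assms by (cases "n = 0") (auto simp: power_0_left)
  have "n ^ m \<le> 2 ^ m * N"
  proof (cases "n = 1")
    case True
    then show ?thesis using assms by simp
  next
    case False
    have "\<not> N \<le> (n - 1) ^ m" using n0 unfolding n_def by (intro not_less_Least) simp
    then have lt: "(n - 1) ^ m \<le> N" by simp
    have "n ^ m \<le> (2 * (n - 1)) ^ m" using n0 False by (intro power_mono) auto
    also have "\<dots> \<le> 2 ^ m * N" using lt by (simp add: power_mult_distrib)
    finally show ?thesis .
  qed
  then show ?thesis using that n by blast
qed

section \<open>The Bohnenblust--Hille constants\<close>

text \<open>For upper bounds the increments may be replaced by the larger pure powers, whose squares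
  are again pure powers, as \<open>weighted_sum_le_mixed_norm\<close> requires.\<close>

lemma xnorm_lorentz_fin_rearr_le:
  assumes p: "1 \<le> p" and I: "finite I"
    and L: "\<And>A \<rho>. A \<subseteq> I \<Longrightarrow> inj_on \<rho> A \<Longrightarrow>
      (\<Sum>i\<in>A. cmod (x i) * real (Suc (\<rho> i)) powr (1/p - 1)) \<le> L"
  shows "xnorm (lorentz_p1 p) (fin_rearr I x) \<le> ennreal L"
proof -
  have "cmod (x i) \<le> (\<Sum>i\<in>I. cmod (x i))" if "i \<in> I" for i
    using that I by (intro member_le_sum) auto
  then have "decr I x k < top" for k by (rule decr_less_top)
  then have "lorentz_p1_norm p (fin_rearr I x) = (\<Sum>k. decr I x k * ennreal (lorentz_weight p k))"
    by (simp add: lorentz_p1_norm_eq[OF p] decr_rearrangement)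
  also have "\<dots> \<le> ennreal L"
  proof (rule lorentz_leI)
    fix A :: "'a set" and \<rho> :: "'a \<Rightarrow> nat" assume A: "A \<subseteq> I" "inj_on \<rho> A"
    have "lorentz_weight p k \<le> real (Suc k) powr (1/p - 1)" for k
      unfolding lorentz_weight_def using p by (intro powr_increment_le) auto
    then have "(\<Sum>i\<in>A. cmod (x i) * lorentz_weight p (\<rho> i)) \<le> L"
      by (intro order_trans[OF _ L[OF A]] sum_mono mult_left_mono) auto
    then show "ennreal (\<Sum>i\<in>A. cmod (x i) * lorentz_weight p (\<rho> i)) \<le> ennreal L"
      by (rule ennreal_leI)
  qed (use lorentz_weight_nonneg[OF p] lorentz_weight_0[OF p] in auto)
  finally have le: "lorentz_p1_norm p (fin_rearr I x) \<le> ennreal L" .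
  then have "lorentz_p1_norm p (fin_rearr I x) < top" by (rule order_le_less_trans) simp
  then show ?thesis using le by (simp add: xnorm_def lorentz_p1_def)
qed

text \<open>The 4 from absorbing the bad points joins the \<open>4 ^ (m - 1)\<close> from
  Khinchine.\<close>

lemma weighted_sum_le_mult_norm:
  assumes m: "1 \<le> m" and A: "A \<subseteq> Mset m n" "inj_on \<rho> A"
  shows "(\<Sum>i\<in>A. cmod (a i) * real (Suc (\<rho> i)) powr ((real m + 1) / (2 * real m) - 1))
    \<le> 4 ^ m * (real m * sqrt (2 * real m + 1)) * mult_norm m n a"
proof -
  have "4 * (real m * sqrt (2 * real m + 1)) * (4 ^ (m - 1) * mult_norm m n a)
      = 4 ^ m * (real m * sqrt (2 * real m + 1)) * mult_norm m n a"
    using m by (cases m) auto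
  then show ?thesis
    using weighted_sum_le_mixed_norm[OF m mixed_norm_le_mult_norm A, of a] by (simp only:)
qed

context
  fixes m :: nat and p :: real
  assumes m: "1 \<le> m" and p: "p = 2 * real m / (real m + 1)"
begin

lemma p_ge_1: "1 \<le> p"
  using m by (simp add: p)

lemma inverse_p: "1 / p = (real m + 1) / (2 * real m)"
  by (simp add: p)

lemma BH_mult_lorentz_p1: "BH_mult (lorentz_p1 p) m < top"
proof -
  define K where "K = max 1 (4 ^ m * (real m * sqrt (2 * real m + 1)))"
  have "xnorm (lorentz_p1 p) (fin_rearr (Mset m n) a) \<le> ennreal K * ennreal (mult_norm m n a)" for n a
  proof -
    have "xnorm (lorentz_p1 p) (fin_rearr (Mset m n) a) \<le> ennreal (K * mult_norm m n a)"
    proof (rule xnorm_lorentz_fin_rearr_le[OF p_ge_1 finite_Mset])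
      fix A and \<rho> :: "(nat \<Rightarrow> nat) \<Rightarrow> nat" assume A: "A \<subseteq> Mset m n" "inj_on \<rho> A"
      show "(\<Sum>i\<in>A. cmod (a i) * real (Suc (\<rho> i)) powr (1/p - 1)) \<le> K * mult_norm m n a"
        unfolding inverse_p
        by (rule order_trans[OF weighted_sum_le_mult_norm[OF m A]])
          (auto simp: K_def mult_norm_nonneg intro!: mult_right_mono)
    qed
    then show ?thesis by (simp add: K_def ennreal_mult mult_norm_nonneg)
  qed
  then have "BH_mult (lorentz_p1 p) m \<le> ennreal K"
    unfolding BH_mult_def by (intro Inf_lower) (auto simp: K_def)
  then show ?thesis by (rule order_le_less_trans) simp
qed

lemma BH_pol_lorentz_p1: "BH_pol (lorentz_p1 p) m < top"
proof -
  define K where "K = max 1 (fact m * (4 ^ m * (real m * sqrt (2 * real m + 1))) * real m ^ m)"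
  have "xnorm (lorentz_p1 p) (fin_rearr (Jset m n) c) \<le> ennreal K * ennreal (pol_norm m n c)" for n c
  proof -
    have "xnorm (lorentz_p1 p) (fin_rearr (Jset m n) c) \<le> ennreal (K * pol_norm m n c)"
    proof (rule xnorm_lorentz_fin_rearr_le[OF p_ge_1 finite_Jset])
      fix A and \<rho> :: "(nat \<Rightarrow> nat) \<Rightarrow> nat" assume A: "A \<subseteq> Jset m n" "inj_on \<rho> A"
      let ?\<beta> = "\<lambda>i. real (Suc (\<rho> i)) powr (1/p - 1)" and ?s = "symmetrized m n c"
      have "(\<Sum>j\<in>A. cmod (c j) * ?\<beta> j) \<le> (\<Sum>j\<in>A. fact m * cmod (?s j) * ?\<beta> j)"
        using A(1) by (intro sum_mono mult_right_mono cmod_le_symmetrized) auto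
      also have "\<dots> = fact m * (\<Sum>j\<in>A. cmod (?s j) * ?\<beta> j)"
        by (simp add: sum_distrib_left mult.assoc)
      also have "\<dots> \<le> fact m * (4 ^ m * (real m * sqrt (2 * real m + 1)) * mult_norm m n ?s)"
        unfolding inverse_p using A
        by (intro mult_left_mono weighted_sum_le_mult_norm[OF m]) (auto simp: Jset_def)
      also have "\<dots> \<le> fact m * (4 ^ m * (real m * sqrt (2 * real m + 1)) * (real m ^ m * pol_norm m n c))"
        by (intro mult_left_mono mult_norm_symmetrized m) auto
      also have "\<dots> = fact m * (4 ^ m * (real m * sqrt (2 * real m + 1))) * real m ^ m * pol_norm m n c"
        by (simp only: mult.assoc)
      also have "\<dots> \<le> K * pol_norm m n c"
        by (intro mult_right_mono pol_norm_nonneg) (simp add: K_def)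
      finally show "(\<Sum>j\<in>A. cmod (c j) * ?\<beta> j) \<le> K * pol_norm m n c" .
    qed
    then show ?thesis by (simp add: K_def ennreal_mult pol_norm_nonneg)
  qed
  then have "BH_pol (lorentz_p1 p) m \<le> ennreal K"
    unfolding BH_pol_def by (intro Inf_lower) (auto simp: K_def)
  then show ?thesis by (rule order_le_less_trans) simp
qed

text \<open>The exponents match because \<open>n^((m+1)/2) = (n^m)^(1/p)\<close>. A size between two
  powers is dominated by the next one, at the cost of \<open>(2^m)^(1/p)\<close>.\<close>

lemma embeds_if_indicator_bound:
  assumes X: "sym_banach_seq_space X" and C: "C < top"
    and le: "\<And>n. xnorm X (initial_indicator (n ^ m)) \<le> C * ennreal (sqrt (real n ^ (m + 1)))"
  shows "embeds (lorentz_p1 p) X"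
proof -
  obtain c where c: "C = ennreal c" "0 \<le> c" using C by (cases C) auto
  have le_c: "initial_indicator (n ^ m) \<in> fst X \<and> snd X (initial_indicator (n ^ m)) \<le> c * sqrt (real n ^ (m + 1))" for n
  proof -
    have *: "xnorm X (initial_indicator (n ^ m)) \<le> ennreal (c * sqrt (real n ^ (m + 1)))"
      using le[of n] c by (simp add: ennreal_mult)
    then have "initial_indicator (n ^ m) \<in> fst X"
      by (auto simp: xnorm_def top_unique split: if_splits)
    then show ?thesis using * c by (simp add: xnorm_def ennreal_le_iff)
  qed
  \<comment> \<open>\<open>c + 1\<close> instead of \<open>c\<close>, because \<open>embeds\<close>
    asks for a positive constant.\<close>
  define K where "K = (c + 1) * (2 ^ m) powr (1/p)"
  have fund: "initial_indicator N \<in> fst X \<and> snd X (initial_indicator N) \<le> K * real N powr (1/p)" for N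
  proof (cases "N = 0")
    case True
    then have "initial_indicator N = (\<lambda>_. 0)" by (simp add: initial_indicator_def)
    then show ?thesis using sbs_zero[OF X] sbs_norm_eq_0[OF X sbs_zero[OF X]] c
      by (simp add: K_def)
  next
    case False
    then obtain n where n: "N \<le> n ^ m" "n ^ m \<le> 2 ^ m * N"
      using ex_power_between[OF m, of N] by auto
    have n0: "0 < n" using n(1) False m by (cases "n = 0") (auto simp: power_0_left)
    have dom: "cmod (initial_indicator N i) \<le> cmod (initial_indicator (n ^ m) i)" for i
      using n(1) by (simp add: initial_indicator_def)
    have "real m * ((real m + 1) / (2 * real m)) = real (m + 1) * (1/2)"
      using m by (simp add: field_simps)
    then have "real (n ^ m) powr (1/p) = real n powr (real (m + 1) * (1/2))"
      using n0 unfolding inverse_p by (simp only: of_nat_power powr_realpow[symmetric] powr_powr of_nat_0_less_iff)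
    also have "\<dots> = (real n ^ (m + 1)) powr (1/2)"
      using n0 by (simp only: powr_powr[symmetric] powr_realpow of_nat_0_less_iff)
    also have "\<dots> = sqrt (real n ^ (m + 1))" by (rule powr_half_sqrt) simp
    finally have eq: "sqrt (real n ^ (m + 1)) = real (n ^ m) powr (1/p)" by simp
    have "snd X (initial_indicator N) \<le> c * sqrt (real n ^ (m + 1))"
      using sbs_norm_mono[OF X _ dom] le_c[of n] by (meson order_trans)
    also have "\<dots> \<le> (c + 1) * real (2 ^ m * N) powr (1/p)"
      unfolding eq using c(2) p_ge_1 n(2)[THEN of_nat_mono, where 'a = real]
      by (intro mult_mono powr_mono2) auto
    also have "\<dots> = K * real N powr (1/p)" by (simp add: K_def powr_mult mult.assoc)
    finally have "snd X (initial_indicator N) \<le> K * real N powr (1/p)" .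
    moreover have "initial_indicator N \<in> fst X"
      using le_c[of n] by (intro sbs_solid[OF X _ dom]) blast
    ultimately show ?thesis by blast
  qed
  show ?thesis
    by (rule embeds_lorentz_p1[OF X p_ge_1, of K]) (use fund c in \<open>auto simp: K_def\<close>)
qed

lemma embeds_if_BH_mult:
  assumes X: "sym_banach_seq_space X" and fin: "BH_mult X m < top"
  shows "embeds (lorentz_p1 p) X"
proof -
  obtain C where C: "C < top"
    "\<And>n a. xnorm X (fin_rearr (Mset m n) a) \<le> C * ennreal (mult_norm m n a)"
    using fin unfolding BH_mult_def Inf_less_iff by auto
  show ?thesis
  proof (rule embeds_if_indicator_bound[OF X C(1)])
    fix n
    have "xnorm X (initial_indicator (n ^ m)) \<le> C * ennreal (mult_norm m n (fourier_matrix m n))"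
      using C(2)[of n "fourier_matrix m n"] by (simp only: fin_rearr_fourier_matrix)
    also have "\<dots> \<le> C * ennreal (sqrt (real n ^ (m + 1)))"
      by (intro mult_left_mono ennreal_leI mult_norm_fourier_matrix m) simp
    finally show "xnorm X (initial_indicator (n ^ m)) \<le> C * ennreal (sqrt (real n ^ (m + 1)))" .
  qed
qed

lemma embeds_if_BH_pol:
  assumes X: "sym_banach_seq_space X" and fin: "BH_pol X m < top"
  shows "embeds (lorentz_p1 p) X"
proof -
  obtain C where C: "C < top"
    "\<And>n c. xnorm X (fin_rearr (Jset m n) c) \<le> C * ennreal (pol_norm m n c)"
    using fin unfolding BH_pol_def Inf_less_iff by auto
  show ?thesis
  proof (rule embeds_if_indicator_bound[OF X C(1)])
    fix n
    have "xnorm X (initial_indicator (n ^ m)) \<le> C * ennreal (pol_norm m (m * n) (block_coeff m n))"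
      using C(2)[of "m * n" "block_coeff m n"] by (simp only: fin_rearr_block_coeff)
    also have "\<dots> \<le> C * ennreal (sqrt (real n ^ (m + 1)))"
      by (intro mult_left_mono ennreal_leI pol_norm_block_coeff m) simp
    finally show "xnorm X (initial_indicator (n ^ m)) \<le> C * ennreal (sqrt (real n ^ (m + 1)))" .
  qed
qed

end

theorem theorem3p1:
  fixes m :: nat and p :: real
  assumes "m \<ge> 1" and "p = 2 * real m / (real m + 1)"
  shows "sym_banach_seq_space (lorentz_p1 p)
       \<and> BH_mult (lorentz_p1 p) m < top
       \<and> (\<forall>X. sym_banach_seq_space X \<and> BH_mult X m < top \<longrightarrow> embeds (lorentz_p1 p) X)
       \<and> BH_pol (lorentz_p1 p) m < top
       \<and> (\<forall>X. sym_banach_seq_space X \<and> BH_pol X m < top \<longrightarrow> embeds (lorentz_p1 p) X)"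
  using sym_banach_lorentz_p1[OF p_ge_1[OF assms]] BH_mult_lorentz_p1[OF assms]
    BH_pol_lorentz_p1[OF assms] embeds_if_BH_mult[OF assms] embeds_if_BH_pol[OF assms]
  by blast

end
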